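(* Assume conditions (M) and (CC). Suppose that $\emptyset\in\Psi$, $\mathsf P\in\mathcal P_\Psi\setminus\mathcal H_0$, and let the detection subsystems be selected so that $$\max_{e\in\mathcal A(\mathsf P)}\mathcal I(\mathsf P,\mathcal H_0;s_e)=\mathcal I(\mathsf P,\mathcal H_0)$$ (which is trivially the case when $s_e=[K]$ for some $e\in\mathcal A(\mathsf P)$). Then, as $\alpha,\beta\to0$, $$\mathsf E_{\mathsf P}[T^*_{det}]\sim\frac{|\log\alpha|}{\mathcal I(\mathsf P,\mathcal H_0)}\sim\inf\{\mathsf E_{\mathsf P}[T]:(T,D)\in\mathcal D_\Psi(\alpha,\beta)\},$$ and, as $\alpha,\beta,\gamma,\delta\to0$ such that $|\log\alpha|\gg|\log\gamma|\vee|\log\delta|$, $$\mathsf E_{\mathsf P}[T^*]\sim\frac{|\log\alpha|}{\mathcal I(\mathsf P,\mathcal H_0)}\sim\inf\{\mathsf E_{\mathsf P}[T]:(T,D)\in\mathcal C_\Psi(\alpha,\beta,\gamma,\delta)\}.$$ If, also, the isolation subsystems are selected so that $\min_{e\in\mathcal A(\mathsf P)}\mathcal I(\mathsf P,\mathcal H_{\Psi,e};s'_e)=\min_{e\in\mathcal A(\mathsf P)}\mathcal I(\mathsf P,\mathcal H_{\Psi,e})$, then, as $\gamma,\delta\to0$ such that $|\log\gamma|\gg|\log\delta|$, $$\mathsf E_{\mathsf P}[T^*_{fwer}]\sim\max_{e\in\mathcal A(\mathsf P)}\Big\{\frac{|\log\gamma|}{\mathcal I(\mathsf P,\mathcal H_0)\wedge\mathcal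 I(\mathsf P,\mathcal H_{\Psi,e})}\Big\}\sim\inf\{\mathsf E_{\mathsf P}[T]:(T,D)\in\mathcal E_\Psi(\gamma,\delta)\}.$$
   Context: Setting. There are $K$ data sources, $[K]=\{1,\dots,K\}$; $X_n^k$ is the random element observed from source $k$ at time $n\in\mathbb N=\{1,2,\dots\}$. For $s\subseteq[K]$: $X_n^s=\{X_n^k:k\in s\}$, $X^s=\{X_n^s:n\in\mathbb N\}$, $\mathcal F_n^s=\sigma(X_1^s,\dots,X_n^s)$; the superscript is omitted when $s=[K]$. $\mathcal P$ is a finite family of distributions of $X$; $\mathsf P^s$ is the law of $X^s$ under $\mathsf P$, and $\mathcal Q^s=\{\mathsf P^s:\mathsf P\in\mathcal Q\}$. $\mathcal K$ is a finite family of subsets of $[K]$ (units). For each $e\in\mathcal K$, $\mathcal H^e$ and $\mathcal G^e$ are nonempty disjoint subfamilies of $\mathcal P^e$; $\mathcal A(\mathsf P)=\{e\in\mathcal K:\mathsf P^e\in\mathcal G^e\}$. $\Psi$ is a family of subsets of $\mathcal K$, and $\mathcal P_\Psi=\{\mathsf P\in\mathcal P:\mathsf P^e\in\mathcal H^e\cup\mathcal G^e\ \forall e\in\mathcal K,\ \mathcal A(\mathsf P)\in\Psi\}$, $\mathcal H_0=\{\mathsf P\in\mathcal P:\mathsf P^e\in\mathcal H^e\ \forall e\}$, $\mathcal H_{\Psi,e}=\{\mathsf P\in\mathcal P_\Psi\setminus\mathcal H_0:e\notin\mathcal A(\mathsf P)\}$, $\mathcal G_{\Psi,e}=\{\mathsf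 P\in\mathcal P_\Psi:e\in\mathcal A(\mathsf P)\}$. Standing assumption: for every $e\in\mathcal K$, $\mathsf P\in\mathcal G_{\Psi,e}\cup\mathcal H_0$, $\mathsf Q\in\mathcal H_{\Psi,e}\cup\mathcal H_0$, $e\subseteq s\subseteq[K]$, $n\in\mathbb N$, $\mathsf P^s,\mathsf Q^s$ are mutually absolutely continuous on $\mathcal F_n^s$; $\Lambda_n(\mathsf P^s,\mathsf Q^s)=\frac{d\mathsf P^s}{d\mathsf Q^s}(\mathcal F_n^s)$, $Z_n=\log\Lambda_n$. Conditions (M) and (CC): for every $e\in\mathcal K$, $\mathsf P\in\mathcal G_{\Psi,e}$, $\mathsf Q\in\mathcal H_{\Psi,e}\cup\mathcal H_0$, $e\subseteq s\subseteq[K]$ there are positive numbers $\mathcal I(\mathsf P^s,\mathsf Q^s)$, $\mathcal I(\mathsf Q^s,\mathsf P^s)$ such that: (M) as $n\to\infty$, $\mathsf P(\max_{1\le m\le n}Z_m(\mathsf P^s,\mathsf Q^s)\ge n\rho)\to0$ for all $\rho>\mathcal I(\mathsf P^s,\mathsf Q^s)$ and $\mathsf Q(\max_{1\le m\le n}Z_m(\mathsf Q^s,\mathsf P^s)\ge n\rho)\to0$ for all $\rho>\mathcal I(\mathsf Q^s,\mathsf P^s)$; (CC) $\sum_{n\ge1}\mathsf P(Z_n(\mathsf P^s,\mathsf Q^s)<n\rho)<\infty$ for all $\rho<\mathcal I(\mathsf P^s,\mathsf Q^s)$ and $\sum_{n\ge1}\mathsf Q(Z_n(\mathsf Q^s,\mathsf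 P^s)<n\rho)<\infty$ for all $\rho<\mathcal I(\mathsf Q^s,\mathsf P^s)$. Notation: $\mathcal I(\mathsf P,\mathsf Q;s)=\mathcal I(\mathsf P^s,\mathsf Q^s)$, $\mathcal I(\mathsf P,\mathcal Q;s)=\min_{\mathsf Q\in\mathcal Q}\mathcal I(\mathsf P,\mathsf Q;s)$; $s$ is omitted when $s=[K]$. Statistics. Each unit has a detection subsystem $s_e$ and an isolation subsystem $s'_e$, $e\subseteq s_e\cap s'_e$, $s_e,s_e'\subseteq[K]$; $$\Lambda_{e,\rm det}(n)=\frac{\max\{\Lambda_n(\mathsf P,\mathsf P_0):\mathsf P\in\mathcal G_{\Psi,e}^{s_e}\}}{\max\{\Lambda_n(\mathsf P,\mathsf P_0):\mathsf P\in\mathcal H_0^{s_e}\}},\qquad \Lambda_{e,\rm iso}(n)=\frac{\max\{\Lambda_n(\mathsf P,\mathsf P_0'):\mathsf P\in\mathcal G_{\Psi,e}^{s'_e}\}}{\max\{\Lambda_n(\mathsf P,\mathsf P_0'):\mathsf P\in\mathcal H_{\Psi,e}^{s'_e}\}},$$ $\mathsf P_0\in\mathcal H_0^{s_e}$, $\mathsf P_0'\in\mathcal H_0^{s'_e}$ arbitrary (families over which maxima are taken are tacitly nonempty); $D_{\rm iso}(n)=\{e:\Lambda_{e,\rm iso}(n)>1\}$. Test classes. A test is $(T,D)$ with $T$ an $\{\mathcal F_n\}$-stopping time, $D$ $\mathcal F_T$-measurable and $\Psi$-valued. $\mathcal D_\Psi(\alpha,\beta)$: $\mathsf P(D\ne\emptyset)\le\alpha$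 on $\mathcal H_0$, $\mathsf P(D=\emptyset)\le\beta$ on $\mathcal P_\Psi\setminus\mathcal H_0$. $\mathcal E_\Psi(\gamma,\delta)$: $\mathsf P(D\setminus\mathcal A(\mathsf P)\ne\emptyset)\le\gamma$, $\mathsf P(\mathcal A(\mathsf P)\setminus D\ne\emptyset)\le\delta$ on $\mathcal P_\Psi$. $\mathcal C_\Psi(\alpha,\beta,\gamma,\delta)$: tests in $\mathcal D_\Psi(\alpha,\beta)$ with $\mathsf P(D\setminus\mathcal A(\mathsf P)\ne\emptyset)\le\gamma$, $\mathsf P(\mathcal A(\mathsf P)\setminus D\ne\emptyset,D\ne\emptyset)\le\delta$ on $\mathcal P_\Psi\setminus\mathcal H_0$. Procedures ($\emptyset\in\Psi$): $T_0=\inf\{n:\Lambda_{e,\rm det}(n)\le1/C_e\ \forall e\}$; $T_{det}=\inf\{n:\Lambda_{e,\rm det}(n)\ge D_e\text{ for some }e\}$; $T_{joint}=\inf\{n:\Lambda_{e,\rm det}(n)\ge D_e\text{ for some }e,\ \Lambda_{e,\rm iso}(n)\notin(1/A_e,B_e)\ \forall e,\ D_{\rm iso}(n)\in\Psi\setminus\{\emptyset\}\}$. $\chi^*_{det}$: $T^*_{det}=T_0\wedge T_{det}$, $D^*_{det}=\emptyset$ iff $T_0<T_{det}$. $\chi^*$: $T^*=T_0\wedge T_{joint}$, $D^*=\emptyset$ if $T_0<T_{joint}$, $D^*=D_{\rm iso}(T^* )$ if $T_{joint}<T_0$. $\chi^*_{fwer}=(T^*_{fwer},D^*_{fwer})$: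 $\chi^*$ with $C_e=A_e$, $D_e=B_e$ for all $e$. Thresholds are functions of the levels in $(0,1)$ such that $\chi^*_{det}\in\mathcal D_\Psi(\alpha,\beta)$, $\chi^*_{fwer}\in\mathcal E_\Psi(\gamma,\delta)$, $\chi^*\in\mathcal C_\Psi(\alpha,\beta,\gamma,\delta)$ for all levels, and for every $e$: $\log A_e\sim|\log\delta|$, $\log B_e\sim|\log\gamma|$, $\log C_e\sim|\log\beta|$, $\log D_e\sim|\log\alpha|$ as the corresponding levels go to $0$ (for $\chi^*_{fwer}$ only the relations for $A_e,B_e$ apply). $x\sim y$ means $x/y\to1$; $x\gg y$ means $x/y\to\infty$. *)

theory Defs
  imports "HOL-Probability.Probability"
begin

section \<open>Multi-source observations\<close>

text \<open>
  A path \<open>\<omega>\<close> assigns to \<open>(n, k)\<close> the value of the observation \<open>X_n^k\<close> of source \<open>k\<close> at time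
  \<open>n \<ge> 1\<close>. We work on the canonical path space, so that the distributions of \<open>X\<close> are probability
  measures on it and \<open>X\<close> is the identity. The value spaces \<open>obs M n k\<close> are arbitrary measurable
  spaces; they share the carrier type \<open>'a\<close> but may have different underlying sets.
\<close>

type_synonym 'a path = "nat \<times> nat \<Rightarrow> 'a"

record 'a multisource =
  nsrc :: nat                                       (* the number K of sources *)
  obs :: "nat \<Rightarrow> nat \<Rightarrow> 'a measure"
  laws :: "'a path measure set"                     (* the family of distributions of X *)
  units :: "nat set set"
  nullf :: "nat set \<Rightarrow> 'a path measure set"         (* H^e *)
  altf :: "nat set \<Rightarrow> 'a path measure set"          (* G^e *)
  Psi :: "nat set set set"
  subdet :: "nat set \<Rightarrow> nat set"                    (* detection subsystem of a unit *)
  subiso :: "nat set \<Rightarrow> nat set"                    (* isolation subsystem of a unit *)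
  refdet :: "nat set \<Rightarrow> 'a path measure"            (* reference law P_0 in the detection statistic *)
  refiso :: "nat set \<Rightarrow> 'a path measure"            (* reference law P_0' in the isolation statistic *)

definition sources :: "'a multisource \<Rightarrow> nat set" where
  "sources M = {1..nsrc M}"

definition pathspace :: "'a multisource \<Rightarrow> nat set \<Rightarrow> 'a path measure" where
  "pathspace M s = PiM ({1..} \<times> s) (\<lambda>(n, k). obs M n k)"

abbreviation paths :: "'a multisource \<Rightarrow> 'a path set" where
  "paths M \<equiv> space (pathspace M (sources M))"

text \<open>The path \<open>X^s\<close> of the sources in \<open>s\<close>, and its law \<open>P^s\<close>.\<close>

definition subpath :: "nat set \<Rightarrow> 'a path \<Rightarrow> 'a path" where
  "subpath s \<omega> = restrict \<omega> ({1..} \<times> s)"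

definition marg :: "'a multisource \<Rightarrow> nat set \<Rightarrow> 'a path measure \<Rightarrow> 'a path measure" where
  "marg M s P = distr P (pathspace M s) (subpath s)"

text \<open>
  The filtration generated by \<open>X^s\<close>, as sub-sigma-algebras of the path space of \<open>X^s\<close>. It is
  indexed by extended naturals: \<open>filt M s (enat n)\<close> is the sigma-algebra of the observations up to
  time \<open>n\<close>, and \<open>filt M s \<infinity>\<close> is that of the whole path.
\<close>

definition filt :: "'a multisource \<Rightarrow> nat set \<Rightarrow> enat \<Rightarrow> 'a path measure" where
  "filt M s t =
     (let J = {n. 1 \<le> n \<and> enat n \<le> t} \<times> s
      in vimage_algebra (space (pathspace M s)) (\<lambda>\<omega>. restrict \<omega> J) (PiM J (\<lambda>(n, k). obs M n k)))"

definition restr_at :: "'a multisource \<Rightarrow> nat set \<Rightarrow> nat \<Rightarrow> 'a path measure \<Rightarrow> 'a path measure" where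
  "restr_at M s n \<mu> = restr_to_subalg \<mu> (filt M s (enat n))"

definition mutually_abs_cont :: "'a measure \<Rightarrow> 'a measure \<Rightarrow> bool" where
  "mutually_abs_cont \<mu> \<nu> \<longleftrightarrow> absolutely_continuous \<mu> \<nu> \<and> absolutely_continuous \<nu> \<mu>"

text \<open>
  The likelihood ratio \<open>\<Lambda>_n(\<mu>, \<nu>) = d\<mu>/d\<nu> (F_n^s)\<close> of two laws \<open>\<mu>\<close>, \<open>\<nu>\<close> of \<open>X^s\<close>, evaluated at
  \<open>X^s\<close>. The library's \<open>RN_deriv \<nu> \<mu>\<close> takes the dominating measure first.
\<close>

definition LR ::
  "'a multisource \<Rightarrow> nat set \<Rightarrow> nat \<Rightarrow> 'a path measure \<Rightarrow> 'a path measure \<Rightarrow> 'a path \<Rightarrow> real" where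
  "LR M s n \<mu> \<nu> \<omega> = enn2real (RN_deriv (restr_at M s n \<nu>) (restr_at M s n \<mu>) (subpath s \<omega>))"

definition LLR ::
  "'a multisource \<Rightarrow> nat set \<Rightarrow> nat \<Rightarrow> 'a path measure \<Rightarrow> 'a path measure \<Rightarrow> 'a path \<Rightarrow> real" where
  "LLR M s n \<mu> \<nu> \<omega> = ln (LR M s n \<mu> \<nu> \<omega>)"

section \<open>Hypotheses\<close>

definition signals :: "'a multisource \<Rightarrow> 'a path measure \<Rightarrow> nat set set" where
  "signals M P = {e \<in> units M. marg M e P \<in> altf M e}"

definition P_Psi :: "'a multisource \<Rightarrow> 'a path measure set" where
  "P_Psi M = {P \<in> laws M. (\<forall>e\<in>units M. marg M e P \<in> nullf M e \<union> altf M e) \<and> signals M P \<in> Psi M}"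

definition H0 :: "'a multisource \<Rightarrow> 'a path measure set" where
  "H0 M = {P \<in> laws M. \<forall>e\<in>units M. marg M e P \<in> nullf M e}"

definition H_Psi :: "'a multisource \<Rightarrow> nat set \<Rightarrow> 'a path measure set" where
  "H_Psi M e = {P \<in> P_Psi M - H0 M. e \<notin> signals M P}"

definition G_Psi :: "'a multisource \<Rightarrow> nat set \<Rightarrow> 'a path measure set" where
  "G_Psi M e = {P \<in> P_Psi M. e \<in> signals M P}"

text \<open>
  The setting: the structural requirements on the data, nonemptiness of the families over which the
  maxima in the statistics are taken, and mutual absolute continuity at every finite time.
\<close>

definition multisource_setting :: "'a multisource \<Rightarrow> bool" where
  "multisource_setting M \<longleftrightarrow>
     finite (laws M) \<and>
     (\<forall>P\<in>laws M. prob_space P \<and> sets P = sets (pathspace M (sources M))) \<and>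
     (\<forall>e\<in>units M. e \<subseteq> sources M) \<and>
     (\<forall>e\<in>units M. nullf M e \<noteq> {} \<and> altf M e \<noteq> {} \<and> nullf M e \<inter> altf M e = {} \<and>
        nullf M e \<subseteq> marg M e ` laws M \<and> altf M e \<subseteq> marg M e ` laws M) \<and>
     Psi M \<subseteq> Pow (units M) \<and>
     (\<forall>e\<in>units M. e \<subseteq> subdet M e \<and> subdet M e \<subseteq> sources M \<and>
        e \<subseteq> subiso M e \<and> subiso M e \<subseteq> sources M) \<and>
     (\<forall>e\<in>units M. refdet M e \<in> marg M (subdet M e) ` H0 M \<and>
        refiso M e \<in> marg M (subiso M e) ` H0 M) \<and>
     H0 M \<noteq> {} \<and> (\<forall>e\<in>units M. G_Psi M e \<noteq> {} \<and> H_Psi M e \<noteq> {}) \<and>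
     (\<forall>e\<in>units M. \<forall>P\<in>G_Psi M e \<union> H0 M. \<forall>Q\<in>H_Psi M e \<union> H0 M. \<forall>s n.
        e \<subseteq> s \<and> s \<subseteq> sources M \<and> 1 \<le> n \<longrightarrow>
        mutually_abs_cont (restr_at M s n (marg M s P)) (restr_at M s n (marg M s Q)))"

section \<open>Information numbers\<close>

text \<open>
  An assignment of information numbers is a function \<open>I \<mu> \<nu>\<close> of two laws of \<open>X^s\<close>; only its values
  on the pairs occurring below are constrained. Laws for different \<open>s\<close> live on different path
  spaces, so \<open>s\<close> need not be an argument of \<open>I\<close>.
\<close>

type_synonym 'a info = "'a path measure \<Rightarrow> 'a path measure \<Rightarrow> real"

definition for_relevant_pairs ::
  "'a multisource \<Rightarrow> (nat set \<Rightarrow> 'a path measure \<Rightarrow> 'a path measure \<Rightarrow> bool) \<Rightarrow> bool" where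
  "for_relevant_pairs M R \<longleftrightarrow>
     (\<forall>e\<in>units M. \<forall>P\<in>G_Psi M e. \<forall>Q\<in>H_Psi M e \<union> H0 M. \<forall>s.
        e \<subseteq> s \<and> s \<subseteq> sources M \<longrightarrow> R s P Q \<and> R s Q P)"

definition info_positive :: "'a multisource \<Rightarrow> 'a info \<Rightarrow> bool" where
  "info_positive M I \<longleftrightarrow> for_relevant_pairs M (\<lambda>s P Q. 0 < I (marg M s P) (marg M s Q))"

definition cond_M :: "'a multisource \<Rightarrow> 'a info \<Rightarrow> bool" where
  "cond_M M I \<longleftrightarrow> for_relevant_pairs M (\<lambda>s P Q.
     \<forall>\<rho>>I (marg M s P) (marg M s Q).
       (\<lambda>n. measure P {\<omega> \<in> paths M.
          Max ((\<lambda>m. LLR M s m (marg M s P) (marg M s Q) \<omega>) ` {1..n}) \<ge> real n * \<rho>}) \<longlonglongrightarrow> 0)"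

definition cond_CC :: "'a multisource \<Rightarrow> 'a info \<Rightarrow> bool" where
  "cond_CC M I \<longleftrightarrow> for_relevant_pairs M (\<lambda>s P Q.
     \<forall>\<rho><I (marg M s P) (marg M s Q).
       (\<lambda>n. measure P {\<omega> \<in> paths M. LLR M s n (marg M s P) (marg M s Q) \<omega> < real n * \<rho>})
         summable_on {1..})"

definition info_min ::
  "'a multisource \<Rightarrow> 'a info \<Rightarrow> 'a path measure \<Rightarrow> 'a path measure set \<Rightarrow> nat set \<Rightarrow> real" where
  "info_min M I P QQ s = Min ((\<lambda>Q. I (marg M s P) (marg M s Q)) ` QQ)"

section \<open>Tests\<close>

text \<open>
  A test consists of a stopping time with values in \<open>{1, 2, \<dots>, \<infinity>}\<close> and a decision measurable with
  respect to the sigma-algebra of that stopping time.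
\<close>

type_synonym 'a test = "('a path \<Rightarrow> enat) \<times> ('a path \<Rightarrow> nat set set)"

definition tests :: "'a multisource \<Rightarrow> 'a test set" where
  "tests M = {(T, D).
     stopping_time (filt M (sources M)) T \<and> (\<forall>\<omega>\<in>paths M. 1 \<le> T \<omega>) \<and>
     D \<in> filtration.pre_sigma (paths M) (filt M (sources M)) T \<rightarrow>\<^sub>M count_space (Psi M)}"

definition D_class :: "'a multisource \<Rightarrow> real \<Rightarrow> real \<Rightarrow> 'a test set" where
  "D_class M \<alpha> \<beta> = {(T, D) \<in> tests M.
     (\<forall>P\<in>H0 M. measure P {\<omega> \<in> paths M. D \<omega> \<noteq> {}} \<le> \<alpha>) \<and>
     (\<forall>P\<in>P_Psi M - H0 M. measure P {\<omega> \<in> paths M. D \<omega> = {}} \<le> \<beta>)}"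

definition E_class :: "'a multisource \<Rightarrow> real \<Rightarrow> real \<Rightarrow> 'a test set" where
  "E_class M \<gamma> \<delta> = {(T, D) \<in> tests M. \<forall>P\<in>P_Psi M.
     measure P {\<omega> \<in> paths M. D \<omega> - signals M P \<noteq> {}} \<le> \<gamma> \<and>
     measure P {\<omega> \<in> paths M. signals M P - D \<omega> \<noteq> {}} \<le> \<delta>}"

definition C_class :: "'a multisource \<Rightarrow> real \<Rightarrow> real \<Rightarrow> real \<Rightarrow> real \<Rightarrow> 'a test set" where
  "C_class M \<alpha> \<beta> \<gamma> \<delta> = {(T, D) \<in> D_class M \<alpha> \<beta>. \<forall>P\<in>P_Psi M - H0 M.
     measure P {\<omega> \<in> paths M. D \<omega> - signals M P \<noteq> {}} \<le> \<gamma> \<and>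
     measure P {\<omega> \<in> paths M. signals M P - D \<omega> \<noteq> {} \<and> D \<omega> \<noteq> {}} \<le> \<delta>}"

definition expected_time :: "'a path measure \<Rightarrow> ('a path \<Rightarrow> enat) \<Rightarrow> ennreal" where
  "expected_time P T = (\<integral>\<^sup>+ \<omega>. ennreal_of_enat (T \<omega>) \<partial>P)"

definition optimal_time :: "'a path measure \<Rightarrow> 'a test set \<Rightarrow> ennreal" where
  "optimal_time P \<C> = (INF (T, D)\<in>\<C>. expected_time P T)"

section \<open>Statistics and procedures\<close>

definition max_LR ::
  "'a multisource \<Rightarrow> nat set \<Rightarrow> nat \<Rightarrow> 'a path measure set \<Rightarrow> 'a path measure \<Rightarrow> 'a path \<Rightarrow> real" where
  "max_LR M s n QQ \<nu> \<omega> = Max ((\<lambda>\<mu>. LR M s n \<mu> \<nu> \<omega>) ` marg M s ` QQ)"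

definition LR_det :: "'a multisource \<Rightarrow> nat set \<Rightarrow> nat \<Rightarrow> 'a path \<Rightarrow> real" where
  "LR_det M e n \<omega> =
     max_LR M (subdet M e) n (G_Psi M e) (refdet M e) \<omega> /
     max_LR M (subdet M e) n (H0 M) (refdet M e) \<omega>"

definition LR_iso :: "'a multisource \<Rightarrow> nat set \<Rightarrow> nat \<Rightarrow> 'a path \<Rightarrow> real" where
  "LR_iso M e n \<omega> =
     max_LR M (subiso M e) n (G_Psi M e) (refiso M e) \<omega> /
     max_LR M (subiso M e) n (H_Psi M e) (refiso M e) \<omega>"

definition D_iso :: "'a multisource \<Rightarrow> nat \<Rightarrow> 'a path \<Rightarrow> nat set set" where
  "D_iso M n \<omega> = {e \<in> units M. LR_iso M e n \<omega> > 1}"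

text \<open>The first time \<open>n \<ge> 1\<close> at which a condition holds, and \<open>\<infinity>\<close> if there is none.\<close>

definition first_time :: "(nat \<Rightarrow> bool) \<Rightarrow> enat" where
  "first_time R = Inf (enat ` {n. 1 \<le> n \<and> R n})"

type_synonym thresholds = "nat set \<Rightarrow> real"

definition T_0 :: "'a multisource \<Rightarrow> thresholds \<Rightarrow> 'a path \<Rightarrow> enat" where
  "T_0 M C \<omega> = first_time (\<lambda>n. \<forall>e\<in>units M. LR_det M e n \<omega> \<le> 1 / C e)"

definition T_det :: "'a multisource \<Rightarrow> thresholds \<Rightarrow> 'a path \<Rightarrow> enat" where
  "T_det M D \<omega> = first_time (\<lambda>n. \<exists>e\<in>units M. LR_det M e n \<omega> \<ge> D e)"

definition T_joint ::
  "'a multisource \<Rightarrow> thresholds \<Rightarrow> thresholds \<Rightarrow> thresholds \<Rightarrow> 'a path \<Rightarrow> enat" where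
  "T_joint M A B D \<omega> = first_time (\<lambda>n.
     (\<exists>e\<in>units M. LR_det M e n \<omega> \<ge> D e) \<and>
     (\<forall>e\<in>units M. LR_iso M e n \<omega> \<notin> {1 / A e <..< B e}) \<and>
     D_iso M n \<omega> \<in> Psi M - {{}})"

definition T_star_det :: "'a multisource \<Rightarrow> thresholds \<Rightarrow> thresholds \<Rightarrow> 'a path \<Rightarrow> enat" where
  "T_star_det M C D \<omega> = min (T_0 M C \<omega>) (T_det M D \<omega>)"

definition T_star ::
  "'a multisource \<Rightarrow> thresholds \<Rightarrow> thresholds \<Rightarrow> thresholds \<Rightarrow> thresholds \<Rightarrow> 'a path \<Rightarrow> enat" where
  "T_star M A B C D \<omega> = min (T_0 M C \<omega>) (T_joint M A B D \<omega>)"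

text \<open>
  The decision rules. That of the pure detection procedure is only prescribed up to the choice of
  its nonempty value, and that of the joint procedure only where \<open>T_0\<close> and \<open>T_joint\<close> differ; hence
  they are rendered as predicates on the decision \<open>d\<close>, not as functions.
\<close>

definition decision_det ::
  "'a multisource \<Rightarrow> thresholds \<Rightarrow> thresholds \<Rightarrow> ('a path \<Rightarrow> nat set set) \<Rightarrow> bool" where
  "decision_det M C D d \<longleftrightarrow> (\<forall>\<omega>\<in>paths M. d \<omega> = {} \<longleftrightarrow> T_0 M C \<omega> < T_det M D \<omega>)"

definition decision_joint ::
  "'a multisource \<Rightarrow> thresholds \<Rightarrow> thresholds \<Rightarrow> thresholds \<Rightarrow> thresholds \<Rightarrow>
   ('a path \<Rightarrow> nat set set) \<Rightarrow> bool" where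
  "decision_joint M A B C D d \<longleftrightarrow> (\<forall>\<omega>\<in>paths M.
     (T_0 M C \<omega> < T_joint M A B D \<omega> \<longrightarrow> d \<omega> = {}) \<and>
     (T_joint M A B D \<omega> < T_0 M C \<omega> \<longrightarrow> d \<omega> = D_iso M (the_enat (T_star M A B C D \<omega>)) \<omega>))"

section \<open>Asymptotics\<close>

text \<open>
  \<open>x \<sim> y\<close>, that is \<open>x / y \<longlongrightarrow> 1\<close>; used for real-valued and for \<open>ennreal\<close>-valued functions (the
  library's \<open>asymp_equiv\<close> does not cover the latter).
\<close>

definition sim :: "'b filter \<Rightarrow> ('b \<Rightarrow> 'c::{topological_space, inverse, one}) \<Rightarrow> ('b \<Rightarrow> 'c) \<Rightarrow> bool"
  where "sim F f g \<longleftrightarrow> ((\<lambda>x. f x / g x) \<longlongrightarrow> 1) F"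

text \<open>
  All levels tend to \<open>0\<close> from the right, jointly and with no relation between their rates.
\<close>

definition levels2 :: "(real \<times> real) filter" where
  "levels2 = at_right 0 \<times>\<^sub>F at_right 0"

definition levels4 :: "(real \<times> real \<times> real \<times> real) filter" where
  "levels4 = at_right 0 \<times>\<^sub>F at_right 0 \<times>\<^sub>F at_right 0 \<times>\<^sub>F at_right 0"

text \<open>
  \<open>such_that_dominates F f g\<close> is the limit \<open>F\<close> taken along \<open>f \<ggreater> g\<close>, that is \<open>f / g \<longlongrightarrow> \<infinity>\<close>: the
  coarsest filter below \<open>F\<close> along which \<open>f / g\<close> tends to infinity.
\<close>

definition such_that_dominates :: "'b filter \<Rightarrow> ('b \<Rightarrow> real) \<Rightarrow> ('b \<Rightarrow> real) \<Rightarrow> 'b filter" where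
  "such_that_dominates F f g = inf F (filtercomap (\<lambda>x. f x / g x) at_top)"

end

theory Submission
  imports Defs
begin

text \<open>
  The expected time is bounded below for every test of the respective class, and above for the
  proposed procedure, by the same rate to first order; since the procedure itself belongs to the class,
  both equivalences follow at once (\<open>sim_if_bounds\<close>).

  \<^emph>\<open>Lower bound.\<close> Let \<open>Q\<close> be a law under which the test must, up to probability \<open>a\<close>, avoid the
  decisions that it must make under \<open>P\<close>: a null law for detection, or a law without signal in
  \<open>e\<close> for isolating the signal in \<open>e\<close>. Before time about \<open>\<bar>ln a\<bar> / I P Q\<close> the log-likelihood ratio of
  \<open>P\<close> against \<open>Q\<close> stays below \<open>\<bar>ln a\<bar>\<close> with high probability, by \<open>cond_M\<close>. A change of measure then
  shows that a test which stops earlier and decides correctly under \<open>P\<close> would err under \<open>Q\<close> with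
  probability larger than \<open>a\<close> (\<open>prob_stop_early_le\<close>). The bound is uniform over tests and passes
  to the infimum (\<open>expected_time_lower_bound\<close>, \<open>optimal_time_asymptotic_lower_bound\<close>). Minimizing
  over \<open>Q\<close> gives the rates \<open>\<bar>ln \<alpha>\<bar> / I0\<close>, where \<open>I0\<close> is the information of \<open>P\<close> against \<open>H0\<close>, for
  detection, and the smaller of this and the isolation information under familywise error control.

  \<^emph>\<open>Upper bound.\<close> All statistics are ratios of maxima of likelihood ratios with respect to an arbitrary
  reference law. By the chain rule the reference cancels, and under \<open>P\<close> each statistic is
  controlled by finitely many log-likelihood ratios of \<open>P\<close> against other laws. By \<open>cond_CC\<close> the
  probabilities that one of these at time \<open>n\<close> is below \<open>n\<close> times a number smaller than its
  information are summable in \<open>n\<close>. So the expected time at which the procedure stops exceeds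
  the deterministic time at which these linear functions cross the logarithmic thresholds by at most a
  constant independent of the thresholds (\<open>T_star_expected_le\<close>). Letting the slopes approach the
  information numbers of the subsystems yields \<open>T_star_asymptotic_upper_bound\<close>. The rates agree
  because the subsystems are assumed to attain the information of the whole system.

  The three procedures differ only in which thresholds matter. Pure detection is dominated by the joint
  procedure with trivial isolation thresholds; in the joint regime the isolation thresholds are of
  lower order; under familywise error control the detection and isolation thresholds for the signals are
  both of order \<open>\<bar>ln \<gamma>\<bar>\<close>, and only those for units without signal are of lower order.
\<close>

section \<open>Radon--Nikodym derivatives of equivalent probability measures\<close>

text \<open>
  The derivative is almost surely finite under \<open>\<nu>\<close>, so nothing is lost by \<open>enn2real\<close>, which sends
  \<open>\<infinity>\<close> to \<open>0\<close>; the claim is then the integral representation of \<open>\<mu> E\<close>.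
\<close>

lemma measure_le_if_RN_deriv_le:
  assumes "prob_space \<mu>" "prob_space \<nu>" and sets: "sets \<mu> = sets \<nu>"
    and ac: "absolutely_continuous \<nu> \<mu>"
    and E: "E \<in> sets \<nu>" and le: "\<And>x. x \<in> E \<Longrightarrow> enn2real (RN_deriv \<nu> \<mu> x) \<le> c"
  shows "measure \<mu> E \<le> c * measure \<nu> E"
proof (cases "E = {}")
  case True
  then show ?thesis by simp
next
  case False
  interpret \<mu>: prob_space \<mu> by fact
  interpret \<nu>: prob_space \<nu> by fact
  obtain x where "x \<in> E" using False by blast
  with le[OF this] have c: "0 \<le> c"
    using enn2real_nonneg order_trans by blast
  have fin: "AE x in \<nu>. RN_deriv \<nu> \<mu> x \<noteq> \<infinity>"
    by (rule \<nu>.RN_deriv_finite) (use ac sets in \<open>auto intro: \<mu>.sigma_finite_measure_axioms\<close>)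
  have "emeasure \<mu> E = (\<integral>\<^sup>+x. RN_deriv \<nu> \<mu> x * indicator E x \<partial>\<nu>)"
    using \<nu>.density_RN_deriv[OF ac sets] E
    by (metis borel_measurable_RN_deriv emeasure_density)
  also have "\<dots> \<le> (\<integral>\<^sup>+x. ennreal c * indicator E x \<partial>\<nu>)"
  proof (rule nn_integral_mono_AE, use fin in eventually_elim)
    fix x assume "RN_deriv \<nu> \<mu> x \<noteq> \<infinity>"
    then have "RN_deriv \<nu> \<mu> x = ennreal (enn2real (RN_deriv \<nu> \<mu> x))"
      by (simp add: ennreal_enn2real less_top)
    then show "RN_deriv \<nu> \<mu> x * indicator E x \<le> ennreal c * indicator E x"
      using le[of x] by (metis ennreal_leI indicator_simps(2) mult_right_mono mult_zero_right zero_le)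
  qed
  also have "\<dots> = ennreal c * emeasure \<nu> E"
    using E by (simp add: nn_integral_cmult_indicator)
  finally show ?thesis
    using c by (simp add: \<mu>.emeasure_eq_measure \<nu>.emeasure_eq_measure flip: ennreal_mult)
qed

text \<open>
  Positivity holds under \<open>\<mu>\<close>, not under \<open>\<nu>\<close>: the set where the derivative vanishes has \<open>\<mu>\<close>-measure
  \<open>0\<close> because the derivative is the density of \<open>\<mu>\<close>.
\<close>

lemma RN_deriv_pos_finite:
  assumes "prob_space \<mu>" "prob_space \<nu>" and sets: "sets \<mu> = sets \<nu>"
    and ac: "absolutely_continuous \<nu> \<mu>"
  shows "AE x in \<mu>. 0 < enn2real (RN_deriv \<nu> \<mu> x)"
proof -
  interpret \<mu>: prob_space \<mu> by fact
  interpret \<nu>: prob_space \<nu> by fact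
  have fin: "AE x in \<nu>. RN_deriv \<nu> \<mu> x \<noteq> \<infinity>"
    by (rule \<nu>.RN_deriv_finite) (use ac sets in \<open>auto intro: \<mu>.sigma_finite_measure_axioms\<close>)
  have 1: "AE x in \<mu>. RN_deriv \<nu> \<mu> x \<noteq> \<infinity>"
    by (rule absolutely_continuous_AE[OF sets ac fin])
  have 2: "AE x in \<mu>. 0 < RN_deriv \<nu> \<mu> x"
    by (subst \<nu>.density_RN_deriv[OF ac sets, symmetric], subst AE_density) auto
  from 1 2 show ?thesis
    by eventually_elim (auto simp: enn2real_positive_iff top.not_eq_extremum)
qed

text \<open>
  The chain rule \<open>d\<mu>/d\<kappa> = d\<mu>/d\<nu> * d\<nu>/d\<kappa>\<close>. It is what makes the arbitrary reference law cancel from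
  the ratios of maximal likelihood ratios.
\<close>

lemma RN_deriv_chain:
  assumes "prob_space \<mu>" "prob_space \<nu>" "prob_space \<kappa>"
    and sets: "sets \<mu> = sets \<kappa>" "sets \<nu> = sets \<kappa>"
    and ac: "absolutely_continuous \<nu> \<mu>" "absolutely_continuous \<kappa> \<nu>"
  shows "AE x in \<mu>. enn2real (RN_deriv \<kappa> \<mu> x) =
           enn2real (RN_deriv \<nu> \<mu> x) * enn2real (RN_deriv \<kappa> \<nu> x)"
proof -
  interpret \<mu>: prob_space \<mu> by fact
  interpret \<nu>: prob_space \<nu> by fact
  interpret \<kappa>: prob_space \<kappa> by fact
  have meas: "RN_deriv \<nu> \<mu> \<in> borel_measurable \<kappa>"
    using sets borel_measurable_RN_deriv[of \<nu> \<mu>] measurable_cong_sets[OF sets(2) refl] by blast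
  have ac': "absolutely_continuous \<kappa> \<mu>"
    using ac unfolding absolutely_continuous_def by blast
  have "density \<kappa> (\<lambda>x. RN_deriv \<kappa> \<nu> x * RN_deriv \<nu> \<mu> x) = density (density \<kappa> (RN_deriv \<kappa> \<nu>)) (RN_deriv \<nu> \<mu>)"
    using meas by (subst density_density_eq) auto
  also have "\<dots> = \<mu>"
    using sets by (simp add: \<kappa>.density_RN_deriv[OF ac(2)] \<nu>.density_RN_deriv[OF ac(1)])
  finally have "AE x in \<kappa>. RN_deriv \<kappa> \<nu> x * RN_deriv \<nu> \<mu> x = RN_deriv \<kappa> \<mu> x"
    using meas by (intro \<kappa>.RN_deriv_unique) auto
  from absolutely_continuous_AE[OF sets(1) ac' this] show ?thesis
    by eventually_elim (metis enn2real_mult mult.commute)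
qed

section \<open>The filtration and the laws of subsystems\<close>

lemma space_filt [simp]: "space (filt M s t) = space (pathspace M s)"
  by (simp add: filt_def Let_def)

lemma restrict_in_pathspace:
  "J \<subseteq> {1..} \<times> s \<Longrightarrow> \<omega> \<in> space (pathspace M s) \<Longrightarrow> restrict \<omega> J \<in> space (PiM J (\<lambda>(n, k). obs M n k))"
  unfolding pathspace_def by (rule measurable_space[OF measurable_restrict_subset])

lemma sets_filt_mono:
  assumes "t \<le> t'"
  shows "sets (filt M s t) \<subseteq> sets (filt M s t')"
proof -
  let ?J = "\<lambda>t. {n. 1 \<le> n \<and> enat n \<le> t} \<times> s"
  let ?N = "\<lambda>t. PiM (?J t) (\<lambda>(n, k). obs M n k)"
  have sub: "?J t \<subseteq> ?J t'" using assms by auto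
  have "(\<lambda>\<omega>. restrict \<omega> (?J t')) \<in> filt M s t' \<rightarrow>\<^sub>M ?N t'"
    unfolding filt_def Let_def by (intro measurable_vimage_algebra1) (auto intro: restrict_in_pathspace)
  moreover have "(\<lambda>\<omega>. restrict \<omega> (?J t)) \<in> ?N t' \<rightarrow>\<^sub>M ?N t"
    using sub by (rule measurable_restrict_subset)
  ultimately have "(\<lambda>\<omega>. restrict (restrict \<omega> (?J t')) (?J t)) \<in> filt M s t' \<rightarrow>\<^sub>M ?N t"
    by (rule measurable_compose)
  also have "(\<lambda>\<omega>. restrict (restrict \<omega> (?J t')) (?J t)) = (\<lambda>\<omega>. restrict \<omega> (?J t))"
    using sub by (auto simp: restrict_def fun_eq_iff)
  finally have "(\<lambda>\<omega>. restrict \<omega> (?J t)) \<in> filt M s t' \<rightarrow>\<^sub>M ?N t" .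
  then show ?thesis
    unfolding filt_def[of M s t] Let_def by (intro sets_image_in_sets) auto
qed

lemma filtration_filt: "filtration (space (pathspace M s)) (filt M s)"
  by standard (auto dest: sets_filt_mono)

lemma subalgebra_filt: "subalgebra (pathspace M s) (filt M s t)"
  unfolding subalgebra_def
proof
  show "sets (filt M s t) \<subseteq> sets (pathspace M s)"
    unfolding filt_def Let_def
    by (intro sets_image_in_sets) (auto simp: pathspace_def intro!: measurable_restrict_subset)
qed simp

text \<open>
  On the canonical path space the system of all sources observes the path itself. The universal
  lower bounds need likelihood ratios only for this system, because a test may use every source.
\<close>

lemma subpath_sources: "\<omega> \<in> paths M \<Longrightarrow> subpath (sources M) \<omega> = \<omega>"
  by (auto simp: subpath_def pathspace_def space_PiM intro: PiE_restrict)

lemma measurable_subpath: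
  "s \<subseteq> sources M \<Longrightarrow> subpath s \<in> pathspace M (sources M) \<rightarrow>\<^sub>M pathspace M s"
  unfolding subpath_def pathspace_def by (rule measurable_restrict_subset) auto

lemma sets_marg [simp]: "sets (marg M s P) = sets (pathspace M s)"
  and space_marg [simp]: "space (marg M s P) = space (pathspace M s)"
  by (simp_all add: marg_def)

lemma subalgebra_marg: "subalgebra (marg M s P) (filt M s t)"
  using subalgebra_filt[of M s t] by (simp add: subalgebra_def)

lemma sets_restr_at [simp]: "sets (restr_at M s n (marg M s P)) = sets (filt M s (enat n))"
  unfolding restr_at_def by (rule sets_restr_to_subalg[OF subalgebra_marg])

lemma signals_units: "signals M P \<subseteq> units M"
  by (auto simp: signals_def)

text \<open>
  The running assumption on the data, made available to automation: \<open>multisource_setting\<close> is a long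
  conjunction, which is taken apart here once.
\<close>

locale multisource_model =
  fixes M :: "'a multisource"
  assumes setting: "multisource_setting M"
begin

lemma
  shows finite_laws: "finite (laws M)"
    and law_props: "\<forall>P\<in>laws M. prob_space P \<and> sets P = sets (pathspace M (sources M))"
    and units_le_sources: "\<forall>e\<in>units M. e \<subseteq> sources M"
    and H0_nonempty: "H0 M \<noteq> {}"
    and G_H_nonempty: "\<forall>e\<in>units M. G_Psi M e \<noteq> {} \<and> H_Psi M e \<noteq> {}"
    and subsystems: "\<forall>e\<in>units M. e \<subseteq> subdet M e \<and> subdet M e \<subseteq> sources M \<and>
        e \<subseteq> subiso M e \<and> subiso M e \<subseteq> sources M"
    and references: "\<forall>e\<in>units M. refdet M e \<in> marg M (subdet M e) ` H0 M \<and>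
        refiso M e \<in> marg M (subiso M e) ` H0 M"
    and null_alt: "\<forall>e\<in>units M. nullf M e \<noteq> {} \<and> altf M e \<noteq> {} \<and> nullf M e \<inter> altf M e = {} \<and>
        nullf M e \<subseteq> marg M e ` laws M \<and> altf M e \<subseteq> marg M e ` laws M"
    and mutually_abs_cont_relevant: "\<forall>e\<in>units M. \<forall>P\<in>G_Psi M e \<union> H0 M. \<forall>Q\<in>H_Psi M e \<union> H0 M. \<forall>s n.
        e \<subseteq> s \<and> s \<subseteq> sources M \<and> 1 \<le> n \<longrightarrow>
        mutually_abs_cont (restr_at M s n (marg M s P)) (restr_at M s n (marg M s Q))"
  using setting unfolding multisource_setting_def by - (elim conjE, assumption)+

lemma
  assumes "e \<in> units M"
  shows unit_le_subdet: "e \<subseteq> subdet M e"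
    and subdet_le_sources: "subdet M e \<subseteq> sources M"
    and unit_le_subiso: "e \<subseteq> subiso M e"
    and subiso_le_sources: "subiso M e \<subseteq> sources M"
    and unit_le_sources: "e \<subseteq> sources M"
    and G_Psi_nonempty: "G_Psi M e \<noteq> {}"
    and H_Psi_nonempty: "H_Psi M e \<noteq> {}"
    and refdet_in_H0: "refdet M e \<in> marg M (subdet M e) ` H0 M"
    and refiso_in_H0: "refiso M e \<in> marg M (subiso M e) ` H0 M"
    and null_alt_disjoint: "nullf M e \<inter> altf M e = {}"
  using assms subsystems units_le_sources G_H_nonempty references null_alt by simp_all

lemma finite_units: "finite (units M)"
proof (rule finite_subset)
  show "units M \<subseteq> Pow (sources M)" using units_le_sources by blast
qed (simp add: sources_def)

lemma
  shows finite_H0: "finite (H0 M)"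
    and finite_G_Psi: "finite (G_Psi M e)"
    and finite_H_Psi: "finite (H_Psi M e)"
    and finite_signals: "finite (signals M P)"
  using finite_laws finite_units
  by (auto simp: H0_def G_Psi_def H_Psi_def P_Psi_def signals_def)

lemma
  shows P_Psi_laws: "P_Psi M \<subseteq> laws M"
    and H0_laws: "H0 M \<subseteq> laws M"
    and G_Psi_laws: "G_Psi M e \<subseteq> laws M"
    and H_Psi_laws: "H_Psi M e \<subseteq> laws M"
  by (auto simp: H0_def G_Psi_def H_Psi_def P_Psi_def)

end

lemma (in multisource_model) signals_H0:
  assumes "Q \<in> H0 M"
  shows "signals M Q = {}"
  using assms null_alt_disjoint unfolding signals_def H0_def by blast

lemma (in multisource_model)
  assumes "P \<in> laws M"
  shows law_prob_space: "prob_space P"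
    and sets_law: "sets P = sets (pathspace M (sources M))"
  using law_props assms by blast+

lemma (in multisource_model) space_law: "P \<in> laws M \<Longrightarrow> space P = paths M"
  by (intro sets_eq_imp_space_eq sets_law)

lemma (in multisource_model) measurable_subpath_law:
  "P \<in> laws M \<Longrightarrow> s \<subseteq> sources M \<Longrightarrow> subpath s \<in> P \<rightarrow>\<^sub>M pathspace M s"
  using measurable_subpath measurable_cong_sets[OF sets_law refl] by blast

lemma (in multisource_model) prob_space_marg: "P \<in> laws M \<Longrightarrow> s \<subseteq> sources M \<Longrightarrow> prob_space (marg M s P)"
  unfolding marg_def by (intro prob_space.prob_space_distr law_prob_space measurable_subpath_law)

lemma (in multisource_model) prob_space_restr_at:
  "P \<in> laws M \<Longrightarrow> s \<subseteq> sources M \<Longrightarrow> prob_space (restr_at M s n (marg M s P))"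
  unfolding restr_at_def by (intro prob_space_restr_to_subalg subalgebra_marg prob_space_marg)

lemma (in multisource_model) marg_sources: "P \<in> laws M \<Longrightarrow> marg M (sources M) P = P"
  unfolding marg_def
  by (rule trans[OF distr_cong[OF refl sets_law[symmetric]] distr_id])
    (auto simp: space_law subpath_sources)

lemma (in multisource_model) AE_law_if_AE_restr_at:
  assumes "P \<in> laws M" "s \<subseteq> sources M" "AE x in restr_at M s n (marg M s P). R x"
  shows "AE \<omega> in P. R (subpath s \<omega>)"
proof (rule AE_distrD[OF measurable_subpath_law[OF assms(1,2)]])
  show "AE x in distr P (pathspace M s) (subpath s). R x"
    using AE_restr_to_subalg[OF subalgebra_marg assms(3)[unfolded restr_at_def]] unfolding marg_def .
qed

section \<open>Likelihood ratios under a law of the model\<close>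

lemma (in multisource_model) measurable_LR:
  assumes "P \<in> laws M" "s \<subseteq> sources M"
  shows "(\<lambda>\<omega>. LR M s n \<mu> (marg M s Q) \<omega>) \<in> borel_measurable P"
proof -
  have "RN_deriv (restr_at M s n (marg M s Q)) \<nu> \<in> borel_measurable (filt M s (enat n))" for \<nu>
    using borel_measurable_RN_deriv measurable_cong_sets[OF sets_restr_at refl] by blast
  then have "RN_deriv (restr_at M s n (marg M s Q)) \<nu> \<in> borel_measurable (pathspace M s)" for \<nu>
    using measurable_from_subalg[OF subalgebra_filt] by blast
  then show ?thesis
    unfolding LR_def by (intro borel_measurable_enn2real measurable_compose[OF measurable_subpath_law[OF assms]])
qed

lemma LR_sources_measurable_filt:
  "(\<lambda>\<omega>. LR M (sources M) n \<mu> (marg M (sources M) Q) \<omega>) \<in> borel_measurable (filt M (sources M) (enat n))"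
proof -
  have *: "RN_deriv (restr_at M (sources M) n (marg M (sources M) Q)) \<nu> \<in> borel_measurable (filt M (sources M) (enat n))" for \<nu>
    using borel_measurable_RN_deriv measurable_cong_sets[OF sets_restr_at refl] by blast
  show ?thesis
    by (subst measurable_cong[where g="\<lambda>\<omega>. enn2real (RN_deriv (restr_at M (sources M) n (marg M (sources M) Q)) (restr_at M (sources M) n \<mu>) \<omega>)"])
      (use * in \<open>auto simp: LR_def subpath_sources\<close>)
qed

lemma LLR_sources_measurable_filt:
  "(\<lambda>\<omega>. LLR M (sources M) n \<mu> (marg M (sources M) Q) \<omega>) \<in> borel_measurable (filt M (sources M) (enat n))"
  unfolding LLR_def using LR_sources_measurable_filt by (rule borel_measurable_ln)

lemma (in multisource_model) ac_restr_at:
  assumes "e \<in> units M" "P \<in> G_Psi M e \<union> H0 M" "Q \<in> H_Psi M e \<union> H0 M" "e \<subseteq> s" "s \<subseteq> sources M" "1 \<le> n"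
  shows "absolutely_continuous (restr_at M s n (marg M s P)) (restr_at M s n (marg M s Q))"
    "absolutely_continuous (restr_at M s n (marg M s Q)) (restr_at M s n (marg M s P))"
proof -
  have "mutually_abs_cont (restr_at M s n (marg M s P)) (restr_at M s n (marg M s Q))"
    using assms mutually_abs_cont_relevant by blast
  then show "absolutely_continuous (restr_at M s n (marg M s P)) (restr_at M s n (marg M s Q))"
    "absolutely_continuous (restr_at M s n (marg M s Q)) (restr_at M s n (marg M s P))"
    by (simp_all add: mutually_abs_cont_def)
qed

text \<open>
  The statistics are defined pointwise from real-valued versions of the derivatives, so \<open>ln\<close> and
  division may return default values on null sets. This lemma and the next one keep such paths away.
\<close>

lemma (in multisource_model) AE_LR_pos:
  assumes "P \<in> laws M" "Q \<in> laws M" "s \<subseteq> sources M"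
    and "absolutely_continuous (restr_at M s n (marg M s Q)) (restr_at M s n (marg M s P))"
  shows "AE \<omega> in P. 0 < LR M s n (marg M s P) (marg M s Q) \<omega>"
  unfolding LR_def
  by (rule AE_law_if_AE_restr_at, fact+, rule RN_deriv_pos_finite)
    (use assms in \<open>auto intro: prob_space_restr_at\<close>)

lemma (in multisource_model) AE_LR_chain:
  assumes "P \<in> laws M" "Q \<in> laws M" "R \<in> laws M" "s \<subseteq> sources M"
    and "absolutely_continuous (restr_at M s n (marg M s Q)) (restr_at M s n (marg M s P))"
    and "absolutely_continuous (restr_at M s n (marg M s R)) (restr_at M s n (marg M s Q))"
  shows "AE \<omega> in P. LR M s n (marg M s P) (marg M s R) \<omega> =
           LR M s n (marg M s P) (marg M s Q) \<omega> * LR M s n (marg M s Q) (marg M s R) \<omega>"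
  unfolding LR_def
  by (rule AE_law_if_AE_restr_at, fact+, rule RN_deriv_chain)
    (use assms in \<open>auto intro: prob_space_restr_at\<close>)

text \<open>
  Change of measure: where the log-likelihood ratio of \<open>P\<close> against \<open>Q\<close> is still below \<open>c\<close>, an event
  cannot be more than \<open>exp c\<close> times as likely under \<open>P\<close> as under \<open>Q\<close>.
\<close>

lemma (in multisource_model) prob_le_exp_mult_prob:
  assumes P: "P \<in> laws M" "Q \<in> laws M"
    and ac: "absolutely_continuous (restr_at M (sources M) n (marg M (sources M) Q))
               (restr_at M (sources M) n (marg M (sources M) P))"
    and E: "E \<in> sets (filt M (sources M) (enat n))"
    and le: "\<And>\<omega>. \<omega> \<in> E \<Longrightarrow> LLR M (sources M) n (marg M (sources M) P) (marg M (sources M) Q) \<omega> < c"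
  shows "measure P E \<le> exp c * measure Q E"
proof -
  let ?s = "sources M"
  have meas: "measure (restr_at M ?s n (marg M ?s R)) E = measure R E" if "R \<in> laws M" for R
    unfolding restr_at_def measure_def
    using emeasure_restr_to_subalg[OF subalgebra_marg E, of R] by (simp add: marg_sources[OF that])
  have "E \<subseteq> paths M" using sets.sets_into_space[OF E] by simp
  then have "enn2real (RN_deriv (restr_at M ?s n (marg M ?s Q)) (restr_at M ?s n (marg M ?s P)) \<omega>) \<le> exp c"
    if "\<omega> \<in> E" for \<omega>
  proof -
    have "LR M ?s n (marg M ?s P) (marg M ?s Q) \<omega> \<le> exp c"
    proof (cases "0 < LR M ?s n (marg M ?s P) (marg M ?s Q) \<omega>")
      case True
      then show ?thesis using le[OF that] by (metis LLR_def exp_le_cancel_iff exp_ln less_imp_le)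
    next
      case False
      then show ?thesis using exp_ge_zero[of c] by linarith
    qed
    then show ?thesis using subpath_sources[of \<omega> M] \<open>E \<subseteq> paths M\<close> that by (auto simp: LR_def)
  qed
  then have "measure (restr_at M ?s n (marg M ?s P)) E \<le> exp c * measure (restr_at M ?s n (marg M ?s Q)) E"
    using ac E P by (intro measure_le_if_RN_deriv_le prob_space_restr_at) auto
  then show ?thesis by (simp add: meas P)
qed

section \<open>Lower bounds on the expected time of a test\<close>

lemma test_stopping_time: "(T, D) \<in> tests M \<Longrightarrow> stopping_time (filt M (sources M)) T"
  by (simp add: tests_def)

text \<open>
  The decision is only known to be measurable for \<open>count_space (Psi M)\<close>; \<open>S\<close> is arbitrary since
  \<open>D\<close> takes its values in \<open>Psi M\<close> anyway.
\<close>

lemma test_decision_in_filt: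
  assumes "(T, D) \<in> tests M"
  shows "{\<omega> \<in> paths M. D \<omega> \<in> S \<and> T \<omega> \<le> t} \<in> sets (filt M (sources M) t)"
proof -
  let ?F = "filtration.pre_sigma (paths M) (filt M (sources M)) T"
  interpret filtration "paths M" "filt M (sources M)" by (rule filtration_filt)
  note T = test_stopping_time[OF assms]
  have D: "D \<in> ?F \<rightarrow>\<^sub>M count_space (Psi M)" using assms by (simp add: tests_def)
  have "D -` (S \<inter> Psi M) \<inter> paths M \<in> sets ?F"
    using measurable_sets[OF D, of "S \<inter> Psi M"] by (simp add: space_pre_sigma)
  from sets_pre_sigmaD[OF T this]
  have "{\<omega> \<in> D -` (S \<inter> Psi M) \<inter> paths M. T \<omega> \<le> t} \<in> sets (filt M (sources M) t)" .
  also have "{\<omega> \<in> D -` (S \<inter> Psi M) \<inter> paths M. T \<omega> \<le> t} = {\<omega> \<in> paths M. D \<omega> \<in> S \<and> T \<omega> \<le> t}"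
    using measurable_space[OF D] by (auto simp: space_pre_sigma)
  finally show ?thesis .
qed

lemma (in multisource_model) sets_filt_imp_sets_law:
  assumes "P \<in> laws M" "E \<in> sets (filt M (sources M) t)"
  shows "E \<in> sets P"
  using subalgebra_filt[of M "sources M" t] assms sets_law by (auto simp: subalgebra_def)

lemma (in multisource_model) test_decision_in_law:
  assumes "P \<in> laws M" "(T, D) \<in> tests M"
  shows "{\<omega> \<in> paths M. D \<omega> \<in> S} \<in> sets P"
  using sets_filt_imp_sets_law[OF assms(1) test_decision_in_filt[OF assms(2), where t=\<infinity>]] by simp

text \<open>
  The heart of the lower bounds. A test that stops by time \<open>N\<close> either decides in \<open>S\<close> at a time
  \<open>m \<le> N\<close> with small log-likelihood ratio, decides outside \<open>S\<close>, or sees a large log-likelihood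
  ratio by time \<open>N\<close>. Change of measure, applied at each value \<open>m\<close> of \<open>T\<close> separately, bounds the first
  possibility by the error probability under \<open>Q\<close>; the second is an error under \<open>P\<close>.
\<close>

lemma (in multisource_model) prob_stop_early_le:
  assumes e: "e \<in> units M" and P: "P \<in> G_Psi M e" and Q: "Q \<in> H_Psi M e \<union> H0 M"
    and test: "(T, D) \<in> tests M" and N: "1 \<le> N"
  shows "measure P {\<omega> \<in> paths M. T \<omega> \<le> enat N}
    \<le> exp c * measure Q {\<omega> \<in> paths M. D \<omega> \<in> S} + measure P {\<omega> \<in> paths M. D \<omega> \<notin> S}
      + measure P {\<omega> \<in> paths M.
          c \<le> Max ((\<lambda>m. LLR M (sources M) m (marg M (sources M) P) (marg M (sources M) Q) \<omega>) ` {1..N})}"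
    (is "_ \<le> exp c * measure Q ?A + measure P ?B + measure P ?C")
proof -
  let ?Z = "\<lambda>m. LLR M (sources M) m (marg M (sources M) P) (marg M (sources M) Q)"
  interpret filtration "paths M" "filt M (sources M)" by (rule filtration_filt)
  have laws: "P \<in> laws M" "Q \<in> laws M"
    using P Q G_Psi_laws H_Psi_laws H0_laws by blast+
  interpret P: prob_space P using laws law_prob_space by blast
  interpret Q: prob_space Q using laws law_prob_space by blast
  note T = test_stopping_time[OF test]
  have Zm: "?Z m \<in> borel_measurable (filt M (sources M) (enat m))" for m
    by (rule LLR_sources_measurable_filt)
  define E where "E m = {\<omega> \<in> paths M. D \<omega> \<in> S \<and> T \<omega> \<le> enat m} \<inter> {\<omega> \<in> paths M. T \<omega> = enat m}
      \<inter> {\<omega> \<in> paths M. ?Z m \<omega> < c}" for m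
  have E: "E m \<in> sets (filt M (sources M) (enat m))" for m
    unfolding E_def
  proof (intro sets.Int test_decision_in_filt[OF test])
    show "{\<omega> \<in> paths M. T \<omega> = enat m} \<in> sets (filt M (sources M) (enat m))"
      using stopping_time_eq_const[OF T, of "enat m"] by (simp add: pred_def)
    show "{\<omega> \<in> paths M. ?Z m \<omega> < c} \<in> sets (filt M (sources M) (enat m))"
      using Zm[of m] borel_measurable_less[OF Zm[of m] borel_measurable_const[of c]] by simp
  qed
  have EP: "E m \<in> sets P" and EQ: "E m \<in> sets Q" for m
    using sets_filt_imp_sets_law E laws by blast+
  have Cset: "?C \<in> sets P"
  proof -
    have eq: "?C = (\<Union>m\<in>{1..N}. {\<omega> \<in> space P. c \<le> ?Z m \<omega>})"
      using N by (auto simp: Max_ge_iff space_law[OF laws(1)])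
    have "?Z m \<in> borel_measurable P" for m
      using Zm[of m] measurable_from_subalg[OF subalgebra_filt Zm[of m]]
        measurable_cong_sets[OF sets_law[OF laws(1)] refl] by blast
    then show ?thesis unfolding eq by measurable
  qed
  have "{\<omega> \<in> paths M. T \<omega> \<le> enat N} \<subseteq> (\<Union>m\<in>{1..N}. E m) \<union> ?B \<union> ?C"
  proof
    fix \<omega> assume \<omega>: "\<omega> \<in> {\<omega> \<in> paths M. T \<omega> \<le> enat N}"
    then have "1 \<le> T \<omega>" using test by (auto simp: tests_def)
    with \<omega> obtain m where m: "T \<omega> = enat m" "m \<in> {1..N}"
      by (cases "T \<omega>") (auto simp: one_enat_def)
    have "\<omega> \<in> ?C" if "c \<le> ?Z m \<omega>"
      using that m(2) \<omega> by (auto intro: order_trans[OF that Max_ge])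
    then show "\<omega> \<in> (\<Union>m\<in>{1..N}. E m) \<union> ?B \<union> ?C"
      using \<omega> m unfolding E_def by fastforce
  qed
  then have "measure P {\<omega> \<in> paths M. T \<omega> \<le> enat N} \<le> measure P ((\<Union>m\<in>{1..N}. E m) \<union> ?B \<union> ?C)"
    using EP Cset test_decision_in_law[OF laws(1) test, of "- S"]
    by (intro P.finite_measure_mono) auto
  also have "\<dots> \<le> measure P (\<Union>m\<in>{1..N}. E m) + measure P ?B + measure P ?C"
    using EP Cset test_decision_in_law[OF laws(1) test, of "- S"]
    by (intro order_trans[OF measure_Un_le] add_right_mono measure_Un_le) auto
  also have "measure P (\<Union>m\<in>{1..N}. E m) \<le> (\<Sum>m\<in>{1..N}. measure P (E m))"
    using EP by (intro P.finite_measure_subadditive_finite) auto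
  also have "\<dots> \<le> (\<Sum>m\<in>{1..N}. exp c * measure Q (E m))"
  proof (rule sum_mono)
    fix m assume "m \<in> {1..N}"
    then show "measure P (E m) \<le> exp c * measure Q (E m)"
      using ac_restr_at[of e P Q "sources M" m] e P Q unit_le_sources[OF e] E[of m] laws
      by (intro prob_le_exp_mult_prob) (auto simp: E_def)
  qed
  also have "\<dots> = exp c * measure Q (\<Union>m\<in>{1..N}. E m)"
    unfolding sum_distrib_left[symmetric]
    using EQ by (subst Q.finite_measure_finite_Union) (auto simp: disjoint_family_on_def E_def)
  also have "\<dots> \<le> exp c * measure Q ?A"
    using test_decision_in_law[OF laws(2) test]
    by (intro mult_left_mono Q.finite_measure_mono) (auto simp: E_def)
  finally show ?thesis by simp
qed

lemma expected_time_ge: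
  assumes "prob_space P" "{\<omega> \<in> space P. T \<omega> \<le> enat N} \<in> sets P"
  shows "ennreal ((real N + 1) * (1 - measure P {\<omega> \<in> space P. T \<omega> \<le> enat N})) \<le> expected_time P T"
proof -
  interpret prob_space P by fact
  let ?A = "{\<omega> \<in> space P. T \<omega> \<le> enat N}"
  have "ennreal ((real N + 1) * (1 - prob ?A)) = ennreal (real N + 1) * emeasure P (space P - ?A)"
    using prob_compl[OF assms(2)] by (simp add: ennreal_mult emeasure_eq_measure)
  also have "\<dots> = (\<integral>\<^sup>+\<omega>. ennreal (real N + 1) * indicator (space P - ?A) \<omega> \<partial>P)"
    using assms(2) by (simp add: nn_integral_cmult_indicator)
  also have "\<dots> \<le> expected_time P T"
    unfolding expected_time_def
  proof (rule nn_integral_mono)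
    fix \<omega> assume "\<omega> \<in> space P"
    moreover have "ennreal (real N + 1) \<le> ennreal_of_enat (T \<omega>)" if "enat N < T \<omega>"
    proof -
      have "ennreal (real N + 1) = ennreal_of_enat (enat (Suc N))"
        by (simp add: ennreal_of_nat_eq_real_of_nat add.commute)
      also have "\<dots> \<le> ennreal_of_enat (T \<omega>)"
        using that by (simp only: ennreal_of_enat_le_iff) (metis Suc_ile_eq)
      finally show ?thesis .
    qed
    ultimately show "ennreal (real N + 1) * indicator (space P - ?A) \<omega> \<le> ennreal_of_enat (T \<omega>)"
      by (auto simp: indicator_def not_le)
  qed
  finally show ?thesis .
qed

lemma eventually_abs_ln_ge: "eventually (\<lambda>a. K \<le> \<bar>ln a\<bar> \<and> 0 < a \<and> a < 1) (at_right (0::real))"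
proof -
  have "eventually (\<lambda>a. ln a \<le> - K) (at_right (0::real))"
    using ln_at_0 unfolding filterlim_at_bot by blast
  moreover have "eventually (\<lambda>a. 0 < a \<and> a < 1) (at_right (0::real))"
    using eventually_at_right_less[of 0] eventually_at_right_real[of 0 "1::real"]
    by (auto elim: eventually_mono)
  ultimately show ?thesis by eventually_elim auto
qed

text \<open>
  With \<open>N\<close> slightly below \<open>\<bar>ln a\<bar> / I\<close> and the level \<open>N * \<rho>\<close>, \<open>\<rho>\<close> slightly above \<open>I\<close>, all three terms of
  the preceding bound are small: the first is at most a positive power of \<open>a\<close>, and the third tends
  to \<open>0\<close> by \<open>cond_M\<close>. Hence \<open>T > N\<close> with probability close to \<open>1\<close>. The bounds on \<open>a\<close> and \<open>b\<close>
  do not depend on the test, as they must not if the infimum over all tests is to be taken.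
\<close>

lemma (in multisource_model) expected_time_lower_bound:
  assumes info: "info_positive M I" "cond_M M I"
    and e: "e \<in> units M" and P: "P \<in> G_Psi M e" and Q: "Q \<in> H_Psi M e \<union> H0 M"
    and "\<kappa> < 1"
  shows "\<exists>b>0. \<forall>\<^sub>F a in at_right 0. \<forall>T D S. (T, D) \<in> tests M \<longrightarrow>
    measure Q {\<omega> \<in> paths M. D \<omega> \<in> S} \<le> a \<longrightarrow> measure P {\<omega> \<in> paths M. D \<omega> \<notin> S} \<le> b \<longrightarrow>
    ennreal (\<kappa> * \<bar>ln a\<bar> / I (marg M (sources M) P) (marg M (sources M) Q)) \<le> expected_time P T"
proof (cases "0 < \<kappa>")
  let ?I = "I (marg M (sources M) P) (marg M (sources M) Q)"
  have I: "0 < ?I"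
    using info(1) e P Q unit_le_sources[OF e]
    unfolding info_positive_def for_relevant_pairs_def by blast
  {
    case False
    then have "\<kappa> * \<bar>ln a\<bar> / ?I \<le> 0" for a
      using I by (simp add: divide_nonpos_pos mult_nonpos_nonneg)
    then show ?thesis by (intro exI[of _ 1]) (simp add: ennreal_neg)
  }
  case True
  define h where "h = (1 - \<kappa>) / 3"
  define c where "c = 1 - h"
  have h: "0 < h" "h < 1/3" and c: "0 < c" "c < 1" using True \<open>\<kappa> < 1\<close> by (auto simp: h_def c_def)
  have c3: "\<kappa> \<le> c ^ 3"
  proof -
    have "\<kappa> = 1 + of_nat 3 * (- h)" by (simp add: h_def field_simps)
    also have "\<dots> \<le> (1 + - h) ^ 3" using h by (intro Bernoulli_inequality) simp
    finally show ?thesis by (simp add: c_def)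
  qed
  define \<rho> where "\<rho> = ?I / c"
  have \<rho>: "?I < \<rho>" using I c by (simp add: \<rho>_def field_simps)
  let ?C = "\<lambda>n. {\<omega> \<in> paths M. real n * \<rho> \<le>
      Max ((\<lambda>m. LLR M (sources M) m (marg M (sources M) P) (marg M (sources M) Q) \<omega>) ` {1..n})}"
  have "(\<lambda>n. measure P (?C n)) \<longlonglongrightarrow> 0"
    using info(2) e P Q \<rho> unit_le_sources[OF e]
    unfolding cond_M_def for_relevant_pairs_def by blast
  then have "\<forall>\<^sub>F n in sequentially. measure P (?C n) < h / 3"
    using h by (intro order_tendstoD(2)) auto
  then obtain N0 where N0: "\<And>n. N0 \<le> n \<Longrightarrow> measure P (?C n) < h / 3"
    by (auto simp: eventually_sequentially)
  have P_law: "P \<in> laws M" using P G_Psi_laws by blast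
  define K where "K = max ((real N0 + 1) * \<rho> / c) (- ln (h / 3) / h)"
  show ?thesis
  proof (intro exI[of _ "h / 3"] conjI)
    show "0 < h / 3" using h by simp
    show "\<forall>\<^sub>F a in at_right 0. \<forall>T D S. (T, D) \<in> tests M \<longrightarrow>
      measure Q {\<omega> \<in> paths M. D \<omega> \<in> S} \<le> a \<longrightarrow> measure P {\<omega> \<in> paths M. D \<omega> \<notin> S} \<le> h / 3 \<longrightarrow>
      ennreal (\<kappa> * \<bar>ln a\<bar> / ?I) \<le> expected_time P T"
      using eventually_abs_ln_ge[of K]
    proof eventually_elim
      case (elim a)
      define N where "N = nat \<lfloor>c * \<bar>ln a\<bar> / \<rho>\<rfloor>"
      have nonneg: "0 \<le> c * \<bar>ln a\<bar> / \<rho>" using c \<rho> I by simp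
      have "real N0 + 1 \<le> c * \<bar>ln a\<bar> / \<rho>"
        using elim c \<rho> I by (auto simp: K_def field_simps)
      then have N_ge: "N0 \<le> N" "1 \<le> N" unfolding N_def by linarith+
      have N_le: "real N \<le> c * \<bar>ln a\<bar> / \<rho>" and N_gt: "c * \<bar>ln a\<bar> / \<rho> \<le> real N + 1"
        using nonneg unfolding N_def by linarith+
      have "exp (real N * \<rho>) * a \<le> exp (c * \<bar>ln a\<bar>) * a"
        using N_le elim \<rho> I by (intro mult_right_mono) (auto simp: field_simps)
      also have "\<dots> = exp (- h * \<bar>ln a\<bar>)"
      proof -
        have "exp (c * \<bar>ln a\<bar>) * a = exp (c * \<bar>ln a\<bar>) * exp (- \<bar>ln a\<bar>)" using elim by simp
        then show ?thesis by (simp add: c_def algebra_simps flip: exp_add)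
      qed
      also have "\<dots> \<le> exp (ln (h / 3))"
        using elim h unfolding K_def by (subst exp_le_cancel_iff) (auto simp: field_simps)
      also have "\<dots> = h / 3" using h by simp
      finally have exp_le: "exp (real N * \<rho>) * a \<le> h / 3" .
      show ?case
      proof (intro allI impI)
        fix T D S
        assume test: "(T, D) \<in> tests M" and Q_le: "measure Q {\<omega> \<in> paths M. D \<omega> \<in> S} \<le> a"
          and P_le: "measure P {\<omega> \<in> paths M. D \<omega> \<notin> S} \<le> h / 3"
        have "exp (real N * \<rho>) * measure Q {\<omega> \<in> paths M. D \<omega> \<in> S} \<le> h / 3"
          using Q_le by (intro order_trans[OF _ exp_le] mult_left_mono) auto
        with prob_stop_early_le[OF e P Q test N_ge(2), of "real N * \<rho>" S] N0[OF N_ge(1)] P_le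
        have "measure P {\<omega> \<in> paths M. T \<omega> \<le> enat N} \<le> h" by linarith
        then have "c \<le> 1 - measure P {\<omega> \<in> paths M. T \<omega> \<le> enat N}" by (simp add: c_def)
        then have "c * \<bar>ln a\<bar> / \<rho> * c \<le> (real N + 1) * (1 - measure P {\<omega> \<in> paths M. T \<omega> \<le> enat N})"
          using N_gt c by (intro mult_mono) auto
        moreover have "\<kappa> * \<bar>ln a\<bar> / ?I \<le> c * \<bar>ln a\<bar> / \<rho> * c"
        proof -
          have "c * \<bar>ln a\<bar> / \<rho> * c = c ^ 3 * (\<bar>ln a\<bar> / ?I)"
            by (simp add: \<rho>_def power3_eq_cube)
          then show ?thesis using mult_right_mono[OF c3, of "\<bar>ln a\<bar> / ?I"] I by simp
        qed
        moreover have "{\<omega> \<in> space P. T \<omega> \<le> enat N} \<in> sets P"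
          using sets_filt_imp_sets_law[OF P_law test_decision_in_filt[OF test, of UNIV]]
          by (simp add: space_law[OF P_law])
        ultimately show "ennreal (\<kappa> * \<bar>ln a\<bar> / ?I) \<le> expected_time P T"
          using expected_time_ge[OF law_prob_space[OF P_law], of T N]
          by (auto simp: space_law[OF P_law] intro: order_trans[OF ennreal_leI])
      qed
    qed
  qed
qed

text \<open>
  The family \<open>\<C>\<close> of tests varies along the filter with the levels; this is possible because the
  preceding bound is uniform over tests.
\<close>

lemma (in multisource_model) optimal_time_asymptotic_lower_bound:
  assumes info: "info_positive M I" "cond_M M I"
    and e: "e \<in> units M" and P: "P \<in> G_Psi M e" and Q: "Q \<in> H_Psi M e \<union> H0 M"
    and "\<kappa> < 1" and a: "filterlim a (at_right 0) F" and b: "filterlim b (at_right 0) F"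
    and errors: "\<forall>\<^sub>F x in F. \<forall>(T, D)\<in>\<C> x. (T, D) \<in> tests M \<and>
      measure Q {\<omega> \<in> paths M. D \<omega> \<in> S} \<le> a x \<and> measure P {\<omega> \<in> paths M. D \<omega> \<notin> S} \<le> b x"
  shows "\<forall>\<^sub>F x in F. ennreal (\<kappa> * \<bar>ln (a x)\<bar> / I (marg M (sources M) P) (marg M (sources M) Q))
    \<le> optimal_time P (\<C> x)"
proof -
  obtain b0 where "0 < b0" and lower: "\<forall>\<^sub>F a in at_right 0. \<forall>T D S. (T, D) \<in> tests M \<longrightarrow>
    measure Q {\<omega> \<in> paths M. D \<omega> \<in> S} \<le> a \<longrightarrow> measure P {\<omega> \<in> paths M. D \<omega> \<notin> S} \<le> b0 \<longrightarrow>
    ennreal (\<kappa> * \<bar>ln a\<bar> / I (marg M (sources M) P) (marg M (sources M) Q)) \<le> expected_time P T"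
    using expected_time_lower_bound[OF info e P Q \<open>\<kappa> < 1\<close>] by blast
  have "\<forall>\<^sub>F b in at_right 0. b \<le> b0"
    using eventually_at_right_real[OF \<open>0 < b0\<close>] by eventually_elim simp
  from eventually_compose_filterlim[OF this b] eventually_compose_filterlim[OF lower a] errors
  show ?thesis
  proof eventually_elim
    case (elim x)
    show ?case
      unfolding optimal_time_def
    proof (intro INF_greatest, clarify)
      fix T D assume "(T, D) \<in> \<C> x"
      then have "(T, D) \<in> tests M" "measure Q {\<omega> \<in> paths M. D \<omega> \<in> S} \<le> a x"
        "measure P {\<omega> \<in> paths M. D \<omega> \<notin> S} \<le> b0"
        using elim(1,3) by fastforce+
      then show "ennreal (\<kappa> * \<bar>ln (a x)\<bar> / I (marg M (sources M) P) (marg M (sources M) Q)) \<le> expected_time P T"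
        using elim(2) by blast
    qed
  qed
qed

section \<open>Upper bounds on the expected time of the procedures\<close>

text \<open>
  Every time \<open>n \<ge> N\<close> before \<open>T\<close> contributes at least \<open>1\<close> to the sum. No measurability of \<open>T\<close> is
  involved, and the case \<open>T = \<infinity>\<close> is included.
\<close>

lemma ennreal_of_enat_le_add_suminf:
  fixes T :: enat and f :: "nat \<Rightarrow> ennreal"
  assumes "1 \<le> N" and f: "\<And>n. N \<le> n \<Longrightarrow> enat n < T \<Longrightarrow> 1 \<le> f n"
  shows "ennreal_of_enat T \<le> of_nat N + (\<Sum>n. f (Suc n))"
proof -
  have le: "of_nat k \<le> of_nat N + (\<Sum>n. f (Suc n))" if "enat k \<le> T" for k
  proof -
    have "(of_nat k :: ennreal) \<le> of_nat N + of_nat (card {N - 1..<k - 1})"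
      using \<open>1 \<le> N\<close> unfolding of_nat_add[symmetric] of_nat_le_iff by auto
    also have "of_nat (card {N - 1..<k - 1}) = (\<Sum>n\<in>{N - 1..<k - 1}. (1::ennreal))" by simp
    also have "\<dots> \<le> (\<Sum>n\<in>{N - 1..<k - 1}. f (Suc n))"
    proof (rule sum_mono)
      fix n assume "n \<in> {N - 1..<k - 1}"
      then have "N \<le> Suc n" "Suc n < k" by auto
      moreover from this(2) have "enat (Suc n) < T"
        using that by (metis enat_ord_simps(2) less_le_trans)
      ultimately show "1 \<le> f (Suc n)" using f by blast
    qed
    also have "\<dots> \<le> (\<Sum>n. f (Suc n))"
      by (intro sum_le_suminf) auto
    finally show ?thesis by (simp add: add_left_mono)
  qed
  show ?thesis
  proof (cases T)
    case (enat k)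
    then show ?thesis using le[of k] by simp
  next
    case infinity
    have "of_nat N + (\<Sum>n. f (Suc n)) = \<infinity>"
    proof (rule ccontr)
      assume "of_nat N + (\<Sum>n. f (Suc n)) \<noteq> \<infinity>"
      then have "of_nat N + (\<Sum>n. f (Suc n)) < \<top>"
        unfolding infinity_ennreal_def by (rule top.not_eq_extremum[THEN iffD1])
      then obtain k where k: "of_nat N + (\<Sum>n. f (Suc n)) \<le> of_nat k"
        using ennreal_Ex_less_of_nat less_imp_le by blast
      have "of_nat (Suc k) \<le> (of_nat k :: ennreal)"
        using le[of "Suc k"] k infinity by (intro order_trans[OF _ k]) simp
      then show False unfolding of_nat_le_iff by simp
    qed
    then show ?thesis by simp
  qed
qed

text \<open>
  The constant \<open>K\<close>, the expected number of bad events, depends neither on the stopping time nor on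
  \<open>N\<close>; hence it disappears when the expected time is divided by a diverging rate.
\<close>

lemma expected_time_le_by_bad_events:
  fixes Bad :: "'i \<Rightarrow> nat \<Rightarrow> 'a path set"
  assumes "prob_space P" "finite X" and Bad: "\<And>i n. i \<in> X \<Longrightarrow> Bad i n \<in> sets P"
    and summable: "\<And>i. i \<in> X \<Longrightarrow> (\<lambda>n. measure P (Bad i n)) summable_on {1..}"
  obtains K where "\<And>T N. 1 \<le> N
    \<Longrightarrow> (\<And>n. N \<le> n \<Longrightarrow> AE \<omega> in P. (\<forall>i\<in>X. \<omega> \<notin> Bad i n) \<longrightarrow> T \<omega> \<le> enat n)
    \<Longrightarrow> expected_time P T \<le> ennreal (real N + K)"
proof
  interpret prob_space P by fact
  define K where "K = (\<Sum>i\<in>X. (\<Sum>n. measure P (Bad i (Suc n))))"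
  have sm: "summable (\<lambda>n. measure P (Bad i (Suc n)))" if "i \<in> X" for i
  proof -
    have "(\<lambda>n. measure P (Bad i (Suc n))) summable_on UNIV"
    proof -
      have "range Suc = {1..}" by (auto simp: image_def Suc_le_eq gr0_conv_Suc)
      then show ?thesis
        using summable[OF that] summable_on_reindex[of Suc UNIV "\<lambda>n. measure P (Bad i n)"]
        by (simp add: o_def)
    qed
    then show ?thesis by (rule summable_on_imp_summable)
  qed
  have K: "0 \<le> K" unfolding K_def by (intro sum_nonneg suminf_nonneg sm) auto
  fix T :: "'a path \<Rightarrow> enat" and N :: nat
  assume N: "1 \<le> N"
    and AE: "\<And>n. N \<le> n \<Longrightarrow> AE \<omega> in P. (\<forall>i\<in>X. \<omega> \<notin> Bad i n) \<longrightarrow> T \<omega> \<le> enat n"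
  let ?f = "\<lambda>n \<omega>. (\<Sum>i\<in>X. indicator (Bad i n) \<omega> :: ennreal)"
  have "AE \<omega> in P. \<forall>n. N \<le> n \<longrightarrow> (\<forall>i\<in>X. \<omega> \<notin> Bad i n) \<longrightarrow> T \<omega> \<le> enat n"
    using AE by (simp add: AE_all_countable)
  then have "AE \<omega> in P. ennreal_of_enat (T \<omega>) \<le> of_nat N + (\<Sum>n. ?f (Suc n) \<omega>)"
  proof eventually_elim
    case (elim \<omega>)
    show ?case
    proof (rule ennreal_of_enat_le_add_suminf[OF N])
      fix n assume "N \<le> n" "enat n < T \<omega>"
      then obtain i where i: "i \<in> X" "\<omega> \<in> Bad i n" using elim by (meson not_le)
      have "(1::ennreal) = indicator (Bad i n) \<omega>" using i by simp
      also have "\<dots> \<le> ?f n \<omega>" using i \<open>finite X\<close> by (intro member_le_sum) auto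
      finally show "1 \<le> ?f n \<omega>" .
    qed
  qed
  then have "expected_time P T \<le> (\<integral>\<^sup>+\<omega>. of_nat N + (\<Sum>n. ?f (Suc n) \<omega>) \<partial>P)"
    unfolding expected_time_def by (rule nn_integral_mono_AE)
  also have "\<dots> = of_nat N + (\<Sum>n. \<Sum>i\<in>X. emeasure P (Bad i (Suc n)))"
    using Bad by (subst nn_integral_add) (auto simp: nn_integral_suminf nn_integral_sum emeasure_space_1)
  also have "(\<Sum>n. \<Sum>i\<in>X. emeasure P (Bad i (Suc n))) = (\<Sum>n. ennreal (\<Sum>i\<in>X. measure P (Bad i (Suc n))))"
    by (simp add: emeasure_eq_measure sum_ennreal)
  also have "\<dots> = ennreal (\<Sum>n. \<Sum>i\<in>X. measure P (Bad i (Suc n)))"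
    using sm by (intro suminf_ennreal2) (auto intro: sum_nonneg summable_sum)
  also have "(\<Sum>n. \<Sum>i\<in>X. measure P (Bad i (Suc n))) = K"
    unfolding K_def using sm by (intro suminf_sum) auto
  also have "of_nat N + ennreal K = ennreal (real N + K)"
    using K by (simp add: ennreal_of_nat_eq_real_of_nat)
  finally show "expected_time P T \<le> ennreal (real N + K)" .
qed

text \<open>
  When \<open>P\<close> is ahead of every \<open>Q\<close> by \<open>c\<close> in log-likelihood, the chain rule turns this into a comparison
  of likelihood ratios with respect to the common reference \<open>R\<close>. Positivity of the ratio of
  \<open>Q\<close> to \<open>R\<close> under \<open>P\<close> is read off from the chain rule as well.
\<close>

lemma (in multisource_model) AE_LR_ge_exp:
  assumes laws: "P \<in> laws M" "R \<in> laws M" "QQ \<subseteq> laws M" "s \<subseteq> sources M"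
    and ac: "absolutely_continuous (restr_at M s n (marg M s R)) (restr_at M s n (marg M s P))"
    "\<And>Q. Q \<in> QQ \<Longrightarrow> absolutely_continuous (restr_at M s n (marg M s Q)) (restr_at M s n (marg M s P))"
    "\<And>Q. Q \<in> QQ \<Longrightarrow> absolutely_continuous (restr_at M s n (marg M s R)) (restr_at M s n (marg M s Q))"
  shows "AE \<omega> in P. (\<forall>Q\<in>QQ. c \<le> LLR M s n (marg M s P) (marg M s Q) \<omega>) \<longrightarrow>
    (\<forall>Q\<in>QQ. 0 < LR M s n (marg M s Q) (marg M s R) \<omega> \<and>
      exp c * LR M s n (marg M s Q) (marg M s R) \<omega> \<le> LR M s n (marg M s P) (marg M s R) \<omega>)"
proof -
  have "finite QQ" using finite_subset[OF laws(3) finite_laws] .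
  have "AE \<omega> in P. \<forall>Q\<in>QQ. 0 < LR M s n (marg M s P) (marg M s Q) \<omega> \<and>
      LR M s n (marg M s P) (marg M s R) \<omega> =
      LR M s n (marg M s P) (marg M s Q) \<omega> * LR M s n (marg M s Q) (marg M s R) \<omega>"
  proof (intro AE_finite_allI \<open>finite QQ\<close> AE_conjI)
    fix Q assume Q: "Q \<in> QQ"
    then have "Q \<in> laws M" using laws by blast
    then show "AE \<omega> in P. 0 < LR M s n (marg M s P) (marg M s Q) \<omega>"
      by (intro AE_LR_pos laws ac Q)
    show "AE \<omega> in P. LR M s n (marg M s P) (marg M s R) \<omega> =
      LR M s n (marg M s P) (marg M s Q) \<omega> * LR M s n (marg M s Q) (marg M s R) \<omega>"
      by (intro AE_LR_chain laws ac Q \<open>Q \<in> laws M\<close>)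
  qed
  moreover have "AE \<omega> in P. 0 < LR M s n (marg M s P) (marg M s R) \<omega>"
    by (intro AE_LR_pos laws ac)
  ultimately show ?thesis
  proof eventually_elim
    case (elim \<omega>)
    show ?case
    proof (intro impI ballI)
      fix Q assume le: "\<forall>Q\<in>QQ. c \<le> LLR M s n (marg M s P) (marg M s Q) \<omega>" and Q: "Q \<in> QQ"
      let ?l = "LR M s n (marg M s P) (marg M s Q) \<omega>"
      have l: "0 < ?l" and eq: "LR M s n (marg M s P) (marg M s R) \<omega> = ?l * LR M s n (marg M s Q) (marg M s R) \<omega>"
        using elim(1) Q by blast+
      have pos: "0 < LR M s n (marg M s Q) (marg M s R) \<omega>"
        using elim(2) l unfolding eq by (simp add: zero_less_mult_iff)
      have "exp c \<le> ?l" using le Q l by (metis LLR_def exp_le_cancel_iff exp_ln)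
      then show "0 < LR M s n (marg M s Q) (marg M s R) \<omega> \<and>
        exp c * LR M s n (marg M s Q) (marg M s R) \<omega> \<le> LR M s n (marg M s P) (marg M s R) \<omega>"
        unfolding eq using pos by (simp add: mult_right_mono)
    qed
  qed
qed

lemma max_LR_eq: "max_LR M s n QQ \<nu> \<omega> = Max ((\<lambda>Q. LR M s n (marg M s Q) \<nu> \<omega>) ` QQ)"
  by (simp add: max_LR_def image_image)

text \<open>
  If \<open>P\<close> is one of the laws in the numerator and beats every law in the denominator by the factor
  \<open>exp c\<close>, so does the ratio of the maxima; the next lemma is the mirror image.
\<close>

lemma max_LR_ratio_large:
  assumes "finite GG" "finite QQ" "QQ \<noteq> {}" "P \<in> GG"
    and "\<And>Q. Q \<in> QQ \<Longrightarrow> 0 < LR M s n (marg M s Q) \<nu> \<omega> \<and>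
      exp c * LR M s n (marg M s Q) \<nu> \<omega> \<le> LR M s n (marg M s P) \<nu> \<omega>"
  shows "exp c \<le> max_LR M s n GG \<nu> \<omega> / max_LR M s n QQ \<nu> \<omega>"
proof -
  let ?x = "\<lambda>Q. LR M s n (marg M s Q) \<nu> \<omega>"
  have "Max (?x ` QQ) \<in> ?x ` QQ" using assms by (intro Max_in) auto
  then obtain Q where Q: "Q \<in> QQ" "max_LR M s n QQ \<nu> \<omega> = ?x Q" by (auto simp: max_LR_eq)
  have "?x P \<le> max_LR M s n GG \<nu> \<omega>" using assms by (auto simp: max_LR_eq)
  with assms(5)[OF Q(1)] show ?thesis unfolding Q(2) by (simp add: pos_le_divide_eq)
qed

lemma max_LR_ratio_small:
  assumes "finite GG" "GG \<noteq> {}" "finite QQ" "P \<in> QQ"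
    and "\<And>Q. Q \<in> GG \<Longrightarrow> 0 < LR M s n (marg M s Q) \<nu> \<omega> \<and>
      exp c * LR M s n (marg M s Q) \<nu> \<omega> \<le> LR M s n (marg M s P) \<nu> \<omega>"
  shows "max_LR M s n GG \<nu> \<omega> / max_LR M s n QQ \<nu> \<omega> \<le> exp (- c)"
proof -
  let ?x = "\<lambda>Q. LR M s n (marg M s Q) \<nu> \<omega>"
  have "Max (?x ` GG) \<in> ?x ` GG" using assms by (intro Max_in) auto
  then obtain Q where Q: "Q \<in> GG" "max_LR M s n GG \<nu> \<omega> = ?x Q" by (auto simp: max_LR_eq)
  have "?x P \<le> max_LR M s n QQ \<nu> \<omega>" using assms by (auto simp: max_LR_eq)
  with assms(5)[OF Q(1)] have le: "exp c * ?x Q \<le> max_LR M s n QQ \<nu> \<omega>" "0 < ?x Q" by auto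
  then have "0 < max_LR M s n QQ \<nu> \<omega>" by (metis exp_gt_zero less_le_trans mult_pos_pos)
  with le show ?thesis unfolding Q(2) by (simp add: pos_divide_le_eq exp_minus field_simps)
qed

lemma (in multisource_model) AE_LR_det_ge:
  assumes e: "e \<in> units M" and P: "P \<in> G_Psi M e" and n: "1 \<le> n"
  shows "AE \<omega> in P. (\<forall>Q\<in>H0 M. c \<le> LLR M (subdet M e) n (marg M (subdet M e) P) (marg M (subdet M e) Q) \<omega>)
    \<longrightarrow> exp c \<le> LR_det M e n \<omega>"
proof -
  let ?s = "subdet M e"
  obtain R where R: "R \<in> H0 M" "refdet M e = marg M ?s R"
    using refdet_in_H0[OF e] by blast
  have s: "e \<subseteq> ?s" "?s \<subseteq> sources M" using unit_le_subdet subdet_le_sources e by auto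
  have "AE \<omega> in P. (\<forall>Q\<in>H0 M. c \<le> LLR M ?s n (marg M ?s P) (marg M ?s Q) \<omega>) \<longrightarrow>
    (\<forall>Q\<in>H0 M. 0 < LR M ?s n (marg M ?s Q) (marg M ?s R) \<omega> \<and>
      exp c * LR M ?s n (marg M ?s Q) (marg M ?s R) \<omega> \<le> LR M ?s n (marg M ?s P) (marg M ?s R) \<omega>)"
    using P R G_Psi_laws H_Psi_laws H0_laws s by (intro AE_LR_ge_exp ac_restr_at[OF e _ _ s n]) auto
  then show ?thesis
    by eventually_elim
      (use P finite_H0 finite_G_Psi H0_nonempty in \<open>auto simp: LR_det_def R(2) intro!: max_LR_ratio_large\<close>)
qed

lemma (in multisource_model) AE_LR_iso_ge:
  assumes e: "e \<in> units M" and P: "P \<in> G_Psi M e" and n: "1 \<le> n"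
  shows "AE \<omega> in P. (\<forall>Q\<in>H_Psi M e. c \<le> LLR M (subiso M e) n (marg M (subiso M e) P) (marg M (subiso M e) Q) \<omega>)
    \<longrightarrow> exp c \<le> LR_iso M e n \<omega>"
proof -
  let ?s = "subiso M e"
  obtain R where R: "R \<in> H0 M" "refiso M e = marg M ?s R" 
    using refiso_in_H0[OF e] by blast
  have s: "e \<subseteq> ?s" "?s \<subseteq> sources M" using unit_le_subiso subiso_le_sources e by auto
  have "AE \<omega> in P. (\<forall>Q\<in>H_Psi M e. c \<le> LLR M ?s n (marg M ?s P) (marg M ?s Q) \<omega>) \<longrightarrow>
    (\<forall>Q\<in>H_Psi M e. 0 < LR M ?s n (marg M ?s Q) (marg M ?s R) \<omega> \<and>
      exp c * LR M ?s n (marg M ?s Q) (marg M ?s R) \<omega> \<le> LR M ?s n (marg M ?s P) (marg M ?s R) \<omega>)"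
    using P R G_Psi_laws H_Psi_laws H0_laws s by (intro AE_LR_ge_exp ac_restr_at[OF e _ _ s n]) auto
  then show ?thesis
    by eventually_elim
      (use e P finite_G_Psi finite_H_Psi H_Psi_nonempty in \<open>auto simp: LR_iso_def R(2) intro!: max_LR_ratio_large\<close>)
qed

lemma (in multisource_model) AE_LR_iso_le:
  assumes e: "e \<in> units M" and P: "P \<in> H_Psi M e" and n: "1 \<le> n"
  shows "AE \<omega> in P. (\<forall>Q\<in>G_Psi M e. c \<le> LLR M (subiso M e) n (marg M (subiso M e) P) (marg M (subiso M e) Q) \<omega>)
    \<longrightarrow> LR_iso M e n \<omega> \<le> exp (- c)"
proof -
  let ?s = "subiso M e"
  obtain R where R: "R \<in> H0 M" "refiso M e = marg M ?s R" 
    using refiso_in_H0[OF e] by blast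
  have s: "e \<subseteq> ?s" "?s \<subseteq> sources M" using unit_le_subiso subiso_le_sources e by auto
  have "AE \<omega> in P. (\<forall>Q\<in>G_Psi M e. c \<le> LLR M ?s n (marg M ?s P) (marg M ?s Q) \<omega>) \<longrightarrow>
    (\<forall>Q\<in>G_Psi M e. 0 < LR M ?s n (marg M ?s Q) (marg M ?s R) \<omega> \<and>
      exp c * LR M ?s n (marg M ?s Q) (marg M ?s R) \<omega> \<le> LR M ?s n (marg M ?s P) (marg M ?s R) \<omega>)"
    using P R G_Psi_laws H_Psi_laws H0_laws s by (intro AE_LR_ge_exp ac_restr_at[OF e _ _ s n]) auto
  then show ?thesis
    by eventually_elim
      (use e P finite_G_Psi finite_H_Psi G_Psi_nonempty in \<open>auto simp: LR_iso_def R(2) intro!: max_LR_ratio_small\<close>)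
qed

lemma first_time_le: "1 \<le> n \<Longrightarrow> R n \<Longrightarrow> first_time R \<le> enat n"
  unfolding first_time_def by (intro Inf_lower) auto

text \<open>
  The stopping rule of the joint procedure is met as soon as every statistic points clearly in the
  direction that is correct under \<open>P\<close>, for then \<open>D_iso\<close> is the true set of signals, which is
  an admissible nonempty decision.
\<close>

lemma T_star_le:
  assumes "signals M P \<in> Psi M" "e \<in> signals M P" "1 \<le> n"
    and D: "D e \<le> LR_det M e n \<omega>"
    and B: "\<And>e. e \<in> signals M P \<Longrightarrow> B e \<le> LR_iso M e n \<omega> \<and> 1 < LR_iso M e n \<omega>"
    and A: "\<And>e. e \<in> units M - signals M P \<Longrightarrow> LR_iso M e n \<omega> \<le> 1 / A e \<and> LR_iso M e n \<omega> < 1"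
  shows "T_star M A B C D \<omega> \<le> enat n"
proof -
  have "D_iso M n \<omega> = signals M P"
    using A B signals_units by (fastforce simp: D_iso_def)
  then have "T_joint M A B D \<omega> \<le> enat n"
    unfolding T_joint_def using assms signals_units
    by (intro first_time_le) fastforce+
  then show ?thesis by (simp add: T_star_def min.coboundedI2)
qed

lemma less_info_minD:
  "finite QQ \<Longrightarrow> r < info_min M I P QQ s \<Longrightarrow> Q \<in> QQ \<Longrightarrow> r < I (marg M s P) (marg M s Q)"
  unfolding info_min_def by (auto intro: less_le_trans)

lemma info_min_pos:
  assumes "info_positive M I" "P \<in> G_Psi M e" "e \<in> units M" "e \<subseteq> s" "s \<subseteq> sources M"
    and "finite QQ" "QQ \<noteq> {}" "QQ \<subseteq> H_Psi M e \<union> H0 M"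
  shows "0 < info_min M I P QQ s"
  using assms unfolding info_min_def info_positive_def for_relevant_pairs_def
  by (subst Min_gr_iff) blast+

lemma info_min_attained:
  assumes "finite QQ" "QQ \<noteq> {}"
  obtains Q where "Q \<in> QQ" "info_min M I P QQ s = I (marg M s P) (marg M s Q)"
proof -
  have "Min ((\<lambda>Q. I (marg M s P) (marg M s Q)) ` QQ) \<in> (\<lambda>Q. I (marg M s P) (marg M s Q)) ` QQ"
    using assms by (intro Min_in) auto
  then show ?thesis using that by (auto simp: info_min_def)
qed

text \<open>
  The core of the upper bounds. By \<open>cond_CC\<close>, the probabilities that one of finitely many log-likelihood
  ratios at time \<open>n\<close> lags behind \<open>n\<close> times a rate below its information number are summable in \<open>n\<close>.
  Off these events, every statistic has crossed its threshold once \<open>N\<close> is so large that the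
  rates times \<open>N\<close> exceed the logarithms of the thresholds. Only one signal \<open>e0\<close> is
  needed for detection. For the units without a signal any positive rate \<open>\<tau>\<close> is good enough, since
  their thresholds \<open>A\<close> are of lower order than the dominating ones in every regime considered.
\<close>

lemma (in multisource_model) T_star_expected_le:
  assumes info: "info_positive M I" "cond_CC M I"
    and P: "P \<in> P_Psi M - H0 M" and e0: "e0 \<in> signals M P"
    and \<rho>: "0 < \<rho>" "\<rho> < info_min M I P (H0 M) (subdet M e0)"
    and \<sigma>: "0 < \<sigma>" "\<And>e. e \<in> signals M P \<Longrightarrow> \<sigma> < info_min M I P (H_Psi M e) (subiso M e)"
  shows "\<exists>\<tau>>0. \<exists>K. \<forall>A B C D N. 1 \<le> N \<longrightarrow> (\<forall>e\<in>units M. 0 < A e \<and> 0 < B e \<and> 0 < D e) \<longrightarrow>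
    ln (D e0) \<le> real N * \<rho> \<longrightarrow> (\<forall>e\<in>signals M P. ln (B e) \<le> real N * \<sigma>) \<longrightarrow>
    (\<forall>e\<in>units M - signals M P. ln (A e) \<le> real N * \<tau>) \<longrightarrow>
    expected_time P (T_star M A B C D) \<le> ennreal (real N + K)"
proof -
  have P_law: "P \<in> laws M" using P P_Psi_laws by blast
  have G: "P \<in> G_Psi M e" if "e \<in> signals M P" for e using that P by (simp add: G_Psi_def)
  have H: "P \<in> H_Psi M e" if "e \<in> units M - signals M P" for e using that P by (simp add: H_Psi_def)
  let ?J = "SIGMA e : units M - signals M P. G_Psi M e"
  define \<tau> where "\<tau> = Min (insert 1 ((\<lambda>(e, Q). I (marg M (subiso M e) P) (marg M (subiso M e) Q)) ` ?J)) / 2"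
  have finJ: "finite ?J" using finite_units finite_G_Psi by auto
  have Ipos: "0 < I (marg M (subiso M e) P) (marg M (subiso M e) Q)" if "(e, Q) \<in> ?J" for e Q
    using info(1) that H[of e] unit_le_subiso[of e] subiso_le_sources[of e] unfolding info_positive_def for_relevant_pairs_def by fastforce
  have \<tau>: "0 < \<tau>"
    unfolding \<tau>_def using finJ Ipos by (auto simp: Min_gr_iff)
  have \<tau>_less: "\<tau> < I (marg M (subiso M e) P) (marg M (subiso M e) Q)" if "(e, Q) \<in> ?J" for e Q
  proof -
    have "2 * \<tau> \<le> I (marg M (subiso M e) P) (marg M (subiso M e) Q)"
      unfolding \<tau>_def using finJ that by (auto intro!: Min_le)
    with \<tau> show ?thesis by simp
  qed
  define X where "X = (\<lambda>Q. (subdet M e0, Q, \<rho>)) ` H0 M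
    \<union> (\<lambda>(e, Q). (subiso M e, Q, \<sigma>)) ` (SIGMA e : signals M P. H_Psi M e)
    \<union> (\<lambda>(e, Q). (subiso M e, Q, \<tau>)) ` ?J"
  define Bad where "Bad = (\<lambda>(s, Q, r) n.
    {\<omega> \<in> paths M. LLR M s n (marg M s P) (marg M s Q) \<omega> < real n * r})"
  have finX: "finite X" unfolding X_def using finite_H0 finite_H_Psi finite_signals finJ by auto
  have X: "s \<subseteq> sources M \<and> (\<lambda>n. measure P (Bad (s, Q, r) n)) summable_on {1..}"
    if "(s, Q, r) \<in> X" for s Q r
    using that unfolding X_def
  proof (elim UnE)
    assume "(s, Q, r) \<in> (\<lambda>Q. (subdet M e0, Q, \<rho>)) ` H0 M"
    then have *: "s = subdet M e0" "Q \<in> H0 M" "r = \<rho>" by auto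
    have "e0 \<in> units M" using e0 signals_units by blast
    moreover have "r < I (marg M s P) (marg M s Q)" using * \<rho>(2) less_info_minD[OF finite_H0] by blast
    ultimately show ?thesis
      using info(2) G[OF e0] * unit_le_subdet[of e0] subdet_le_sources[of e0]
      unfolding cond_CC_def for_relevant_pairs_def Bad_def by auto
  next
    assume "(s, Q, r) \<in> (\<lambda>(e, Q). (subiso M e, Q, \<sigma>)) ` (SIGMA e : signals M P. H_Psi M e)"
    then obtain e where *: "s = subiso M e" "e \<in> signals M P" "Q \<in> H_Psi M e" "r = \<sigma>" by auto
    have "e \<in> units M" using * signals_units by blast
    moreover have "r < I (marg M s P) (marg M s Q)" using * \<sigma>(2) less_info_minD[OF finite_H_Psi] by blast
    ultimately show ?thesis
      using info(2) G[OF *(2)] * unit_le_subiso[of e] subiso_le_sources[of e]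
      unfolding cond_CC_def for_relevant_pairs_def Bad_def by auto
  next
    assume "(s, Q, r) \<in> (\<lambda>(e, Q). (subiso M e, Q, \<tau>)) ` ?J"
    then obtain e where *: "s = subiso M e" "(e, Q) \<in> ?J" "r = \<tau>" by auto
    then have "e \<in> units M" "Q \<in> G_Psi M e" "P \<in> H_Psi M e" using H by auto
    then show ?thesis
      using info(2) * \<tau>_less[of e Q] unit_le_subiso[of e] subiso_le_sources[of e]
      unfolding cond_CC_def for_relevant_pairs_def Bad_def by fastforce
  qed
  have Bad: "Bad i n \<in> sets P" if "i \<in> X" for i n
  proof -
    obtain s Q r where i: "i = (s, Q, r)" by (cases i)
    have "(\<lambda>\<omega>. LLR M s n (marg M s P) (marg M s Q) \<omega>) \<in> borel_measurable P"
      unfolding LLR_def using X[of s Q r] that i by (intro borel_measurable_ln measurable_LR P_law) auto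
    from borel_measurable_less[OF this borel_measurable_const[of "real n * r"]]
    show ?thesis unfolding Bad_def i by (simp add: space_law[OF P_law])
  qed
  obtain K where K: "\<And>T N. 1 \<le> N
    \<Longrightarrow> (\<And>n. N \<le> n \<Longrightarrow> AE \<omega> in P. (\<forall>i\<in>X. \<omega> \<notin> Bad i n) \<longrightarrow> T \<omega> \<le> enat n)
    \<Longrightarrow> expected_time P T \<le> ennreal (real N + K)"
    using expected_time_le_by_bad_events[where Bad=Bad, OF law_prob_space[OF P_law] finX Bad] X by force
  show ?thesis
  proof (rule exI[of _ \<tau>], intro conjI \<tau> exI[of _ K] allI impI)
    fix A B C D :: thresholds and N :: nat
    assume N: "1 \<le> N" and pos: "\<forall>e\<in>units M. 0 < A e \<and> 0 < B e \<and> 0 < D e"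
      and D: "ln (D e0) \<le> real N * \<rho>" and B: "\<forall>e\<in>signals M P. ln (B e) \<le> real N * \<sigma>"
      and A: "\<forall>e\<in>units M - signals M P. ln (A e) \<le> real N * \<tau>"
    show "expected_time P (T_star M A B C D) \<le> ennreal (real N + K)"
    proof (rule K[OF N])
      fix n assume "N \<le> n"
      then have n: "1 \<le> n" using N by simp
      have le_exp: "x \<le> exp (real n * r)" if "0 < r" "0 < x" "ln x \<le> real N * r" for r x :: real
      proof -
        have "ln x \<le> real n * r"
          using that \<open>N \<le> n\<close> by (intro order_trans[OF that(3)] mult_right_mono) auto
        then show ?thesis using that(2) by (metis exp_le_cancel_iff exp_ln)
      qed
      have "AE \<omega> in P. (\<forall>Q\<in>H0 M. n * \<rho> \<le> LLR M (subdet M e0) n (marg M (subdet M e0) P) (marg M (subdet M e0) Q) \<omega>)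
          \<longrightarrow> exp (n * \<rho>) \<le> LR_det M e0 n \<omega>"
        using e0 signals_units by (intro AE_LR_det_ge G n) auto
      moreover have "AE \<omega> in P. \<forall>e\<in>signals M P.
          (\<forall>Q\<in>H_Psi M e. n * \<sigma> \<le> LLR M (subiso M e) n (marg M (subiso M e) P) (marg M (subiso M e) Q) \<omega>)
          \<longrightarrow> exp (n * \<sigma>) \<le> LR_iso M e n \<omega>"
        using signals_units by (intro AE_finite_allI finite_signals AE_LR_iso_ge G n) auto
      moreover have "AE \<omega> in P. \<forall>e\<in>units M - signals M P.
          (\<forall>Q\<in>G_Psi M e. n * \<tau> \<le> LLR M (subiso M e) n (marg M (subiso M e) P) (marg M (subiso M e) Q) \<omega>)
          \<longrightarrow> LR_iso M e n \<omega> \<le> exp (- (n * \<tau>))"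
        using finite_units by (intro AE_finite_allI AE_LR_iso_le H n) auto
      moreover have "AE \<omega> in P. \<omega> \<in> paths M"
        using AE_space[of P] by (simp add: space_law[OF P_law])
      ultimately show "AE \<omega> in P. (\<forall>i\<in>X. \<omega> \<notin> Bad i n) \<longrightarrow> T_star M A B C D \<omega> \<le> enat n"
      proof eventually_elim
        case (elim \<omega>)
        show ?case
        proof
          assume good: "\<forall>i\<in>X. \<omega> \<notin> Bad i n"
          then have *: "real n * r \<le> LLR M s n (marg M s P) (marg M s Q) \<omega>" if "(s, Q, r) \<in> X" for s Q r
            using that elim(4) by (force simp: Bad_def not_less)
          show "T_star M A B C D \<omega> \<le> enat n"
          proof (rule T_star_le[OF _ e0 n])
            show "signals M P \<in> Psi M" using P by (simp add: P_Psi_def)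
            have e0u: "e0 \<in> units M" using e0 signals_units by blast
            then have "D e0 \<le> exp (n * \<rho>)" using le_exp[OF \<rho>(1) _ D] pos by blast
            also have "\<dots> \<le> LR_det M e0 n \<omega>"
              using elim(1) * by (simp add: X_def)
            finally show "D e0 \<le> LR_det M e0 n \<omega>" .
          next
            fix e assume e: "e \<in> signals M P"
            have le: "exp (n * \<sigma>) \<le> LR_iso M e n \<omega>"
              using elim(2) e by (force intro: * simp: X_def)
            have "B e \<le> exp (n * \<sigma>)"
              using le_exp[OF \<sigma>(1) _ B[rule_format, OF e]] pos e signals_units by blast
            moreover have "1 < exp (n * \<sigma>)" using n \<sigma>(1) by simp
            ultimately show "B e \<le> LR_iso M e n \<omega> \<and> 1 < LR_iso M e n \<omega>" using le by linarith
          next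
            fix e assume e: "e \<in> units M - signals M P"
            have le: "LR_iso M e n \<omega> \<le> exp (- (n * \<tau>))"
              using elim(3) e by (force intro: * simp: X_def)
            have "A e \<le> exp (n * \<tau>)"
              using le_exp[OF \<tau> _ A[rule_format, OF e]] pos e by blast
            then have "exp (- (n * \<tau>)) \<le> 1 / A e"
              using pos e by (simp add: exp_minus field_simps)
            moreover have "exp (- (n * \<tau>)) < 1" using n \<tau> by simp
            ultimately show "LR_iso M e n \<omega> \<le> 1 / A e \<and> LR_iso M e n \<omega> < 1" using le by linarith
          qed
        qed
      qed
    qed
  qed
qed

text \<open>
  One statement covers the three procedures: \<open>x\<close> is the logarithm of the dominating level, and the
  hypotheses say that after time \<open>x / r\<close> detection by \<open>e0\<close>, isolation of the signals, and rejection of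
  the remaining units are all completed up to lower order.
\<close>

lemma (in multisource_model) T_star_asymptotic_upper_bound:
  fixes F :: "'b filter" and x :: "'b \<Rightarrow> real" and A B C D :: "'b \<Rightarrow> thresholds"
  assumes info: "info_positive M I" "cond_CC M I"
    and P: "P \<in> P_Psi M - H0 M" and e0: "e0 \<in> signals M P"
    and I0: "I0 = info_min M I P (H0 M) (subdet M e0)"
    and J: "0 < J" "\<And>e. e \<in> signals M P \<Longrightarrow> J \<le> info_min M I P (H_Psi M e) (subiso M e)"
    and r: "0 < r" and x: "filterlim x at_top F"
    and pos: "\<forall>\<^sub>F b in F. \<forall>e\<in>units M. 0 < A b e \<and> 0 < B b e \<and> 0 < D b e"
    and D: "\<And>c. 1 < c \<Longrightarrow> \<forall>\<^sub>F b in F. ln (D b e0) \<le> c * x b * I0 / r"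
    and B: "\<And>c e. 1 < c \<Longrightarrow> e \<in> signals M P \<Longrightarrow> \<forall>\<^sub>F b in F. ln (B b e) \<le> c * x b * J / r"
    and A: "\<And>\<eta> e. 0 < \<eta> \<Longrightarrow> e \<in> units M - signals M P \<Longrightarrow> \<forall>\<^sub>F b in F. ln (A b e) \<le> \<eta> * x b"
    and \<kappa>: "1 < \<kappa>"
  shows "\<forall>\<^sub>F b in F. expected_time P (T_star M (A b) (B b) (C b) (D b)) \<le> ennreal (\<kappa> * x b / r)"
proof -
  have "0 < I0"
    unfolding I0 using e0 P signals_units
    by (intro info_min_pos[OF info(1), of P e0] finite_H0 H0_nonempty unit_le_subdet subdet_le_sources) (auto simp: G_Psi_def)
  define c where "c = sqrt ((1 + \<kappa>) / 2)"
  have c: "1 < c" "c * c < \<kappa>" using \<kappa> by (auto simp: c_def)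
  have \<rho>: "0 < I0 / c" "I0 / c < info_min M I P (H0 M) (subdet M e0)"
    using \<open>0 < I0\<close> c(1) I0 by (simp_all add: field_simps)
  have \<sigma>: "0 < J / c" "\<And>e. e \<in> signals M P \<Longrightarrow> J / c < info_min M I P (H_Psi M e) (subiso M e)"
  proof -
    show "0 < J / c" using J(1) c(1) by simp
    have "J / c < J" using J(1) c(1) by (simp add: field_simps)
    then show "J / c < info_min M I P (H_Psi M e) (subiso M e)" if "e \<in> signals M P" for e
      using J(2)[OF that] by simp
  qed
  obtain \<tau> K where \<tau>: "0 < \<tau>"
    and K: "\<forall>A B C D N. 1 \<le> N \<longrightarrow> (\<forall>e\<in>units M. 0 < A e \<and> 0 < B e \<and> 0 < D e) \<longrightarrow>
      ln (D e0) \<le> real N * (I0 / c) \<longrightarrow> (\<forall>e\<in>signals M P. ln (B e) \<le> real N * (J / c)) \<longrightarrow>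
      (\<forall>e\<in>units M - signals M P. ln (A e) \<le> real N * \<tau>) \<longrightarrow>
      expected_time P (T_star M A B C D) \<le> ennreal (real N + K)"
    using T_star_expected_le[OF info P e0 \<rho> \<sigma>] by blast
  define y where "y = max 1 ((K + 1) * r / (\<kappa> - c * c))"
  have "\<forall>\<^sub>F b in F. \<forall>e\<in>signals M P. ln (B b e) \<le> c * x b * J / r"
    using B[OF c(1)] finite_signals by (simp add: eventually_ball_finite)
  moreover have "\<forall>\<^sub>F b in F. \<forall>e\<in>units M - signals M P. ln (A b e) \<le> (c * c * \<tau> / r) * x b"
    using A[of "c * c * \<tau> / r"] finite_units \<tau> c(1) r by (simp add: eventually_ball_finite)
  moreover have "\<forall>\<^sub>F b in F. y \<le> x b" using x unfolding filterlim_at_top by blast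
  ultimately show ?thesis
    using pos D[OF c(1)]
  proof eventually_elim
    case (elim b)
    define N where "N = nat \<lceil>c * c * x b / r\<rceil>"
    have xb: "1 \<le> x b" "(K + 1) * r / (\<kappa> - c * c) \<le> x b" using elim(3) by (auto simp: y_def)
    have pos': "0 < c * c * x b / r" using c r xb by simp
    then have N: "1 \<le> N" "c * c * x b / r \<le> real N" "real N \<le> c * c * x b / r + 1"
      unfolding N_def by linarith+
    have scale: "c * x b * z / r \<le> real N * (z / c)" if "0 < z" for z
    proof -
      have "c * x b * z / r = (c * c * x b / r) * (z / c)" using c by simp
      also have "\<dots> \<le> real N * (z / c)" using N(2) that c by (intro mult_right_mono) auto
      finally show ?thesis .
    qed
    have "(c * c * \<tau> / r) * x b \<le> real N * \<tau>"
      using mult_right_mono[OF N(2), of \<tau>] \<tau> by (simp add: mult_ac)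
    then have "expected_time P (T_star M (A b) (B b) (C b) (D b)) \<le> ennreal (real N + K)"
      using elim scale[OF \<open>0 < I0\<close>] scale[OF J(1)] by (intro K[rule_format] N(1)) force+
    also have "\<dots> \<le> ennreal (\<kappa> * x b / r)"
    proof (rule ennreal_leI)
      have "K + 1 \<le> (\<kappa> - c * c) * x b / r"
        using xb(2) c(2) r by (simp add: field_simps)
      then show "real N + K \<le> \<kappa> * x b / r"
        using N(3) by (simp add: diff_divide_distrib left_diff_distrib)
    qed
    finally show ?case .
  qed
qed

text \<open>
  The joint procedure only adds conditions to the detection rule. Upper bounds for the joint procedure
  with trivial thresholds \<open>A = B = 1\<close>, which impose no delay asymptotically, thus apply to pure
  detection.
\<close>

lemma T_star_det_le_T_star: "T_star_det M C D \<omega> \<le> T_star M A B C D \<omega>"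
proof -
  have "T_det M D \<omega> \<le> T_joint M A B D \<omega>"
    unfolding T_det_def T_joint_def first_time_def by (intro Inf_superset_mono image_mono) auto
  then show ?thesis unfolding T_star_det_def T_star_def by (simp add: min.coboundedI2)
qed

lemma expected_time_mono: "(\<And>\<omega>. T \<omega> \<le> T' \<omega>) \<Longrightarrow> expected_time P T \<le> expected_time P T'"
  unfolding expected_time_def by (intro nn_integral_mono) (simp add: ennreal_of_enat_le_iff)

section \<open>Asymptotic equivalence from two-sided bounds\<close>

lemma tendsto_ratio_if_bounds:
  fixes f :: "'b \<Rightarrow> ennreal"
  assumes x: "filterlim x at_top F" and r: "0 < r"
    and lower: "\<And>\<kappa>. 0 < \<kappa> \<Longrightarrow> \<kappa> < 1 \<Longrightarrow> \<forall>\<^sub>F b in F. ennreal (\<kappa> * x b / r) \<le> f b"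
    and upper: "\<And>\<kappa>. 1 < \<kappa> \<Longrightarrow> \<forall>\<^sub>F b in F. f b \<le> ennreal (\<kappa> * x b / r)"
  shows "((\<lambda>b. enn2real (f b) / (x b / r)) \<longlongrightarrow> 1) F"
    and "\<forall>\<^sub>F b in F. 0 < x b \<and> 0 < enn2real (f b) \<and> f b = ennreal (enn2real (f b))"
proof -
  have x_pos: "\<forall>\<^sub>F b in F. 0 < x b"
    using x unfolding filterlim_at_top_dense by blast
  have fin: "\<forall>\<^sub>F b in F. f b = ennreal (enn2real (f b))"
    using upper[of 2, simplified]
    by eventually_elim (metis ennreal_enn2real ennreal_less_top le_less_trans)
  have lower': "\<forall>\<^sub>F b in F. \<kappa> \<le> enn2real (f b) / (x b / r)" if "0 < \<kappa>" "\<kappa> < 1" for \<kappa>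
    using lower[OF that] fin x_pos
  proof eventually_elim
    case (elim b)
    then have "\<kappa> * x b / r \<le> enn2real (f b)"
      by (metis ennreal_le_iff enn2real_nonneg)
    with elim(3) r show ?case by (simp add: field_simps)
  qed
  show "\<forall>\<^sub>F b in F. 0 < x b \<and> 0 < enn2real (f b) \<and> f b = ennreal (enn2real (f b))"
    using lower'[of "1/2", simplified] fin x_pos
    by eventually_elim (use r in \<open>auto simp: enn2real_nonneg less_le\<close>)
  show "((\<lambda>b. enn2real (f b) / (x b / r)) \<longlongrightarrow> 1) F"
  proof (rule order_tendstoI)
    fix a :: real assume "a < 1"
    define \<kappa> where "\<kappa> = max ((a + 1) / 2) (1 / 2)"
    have "0 < \<kappa>" "\<kappa> < 1" "a < \<kappa>" using \<open>a < 1\<close> by (auto simp: \<kappa>_def max_def)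
    from lower'[OF this(1,2)] show "\<forall>\<^sub>F b in F. a < enn2real (f b) / (x b / r)"
      by eventually_elim (use \<open>a < \<kappa>\<close> in simp)
  next
    fix a :: real assume "1 < a"
    then have "1 < (a + 1) / 2" "(a + 1) / 2 < a" by auto
    from upper[OF this(1)] x_pos fin show "\<forall>\<^sub>F b in F. enn2real (f b) / (x b / r) < a"
    proof eventually_elim
      case (elim b)
      then have "enn2real (f b) \<le> (a + 1) / 2 * x b / r"
        using \<open>1 < a\<close> r by (intro enn2real_leI) auto
      then have "enn2real (f b) / (x b / r) \<le> (a + 1) / 2"
        using elim(2) r by (simp add: field_simps)
      then show ?case using \<open>(a + 1) / 2 < a\<close> by linarith
    qed
  qed
qed

text \<open>
  It suffices to bound the optimum from below and one member of the class from above, both by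
  multiples of the rate arbitrarily close to \<open>1\<close>: the optimum lies below the member. Values
  in \<open>ennreal\<close> are eventually finite and positive, so that quotients can be computed in the reals.
\<close>

lemma sim_if_bounds:
  fixes T opt :: "'b \<Rightarrow> ennreal"
  assumes x: "filterlim x at_top F" and r: "0 < r"
    and lower: "\<And>\<kappa>. 0 < \<kappa> \<Longrightarrow> \<kappa> < 1 \<Longrightarrow> \<forall>\<^sub>F b in F. ennreal (\<kappa> * x b / r) \<le> opt b"
    and upper: "\<And>\<kappa>. 1 < \<kappa> \<Longrightarrow> \<forall>\<^sub>F b in F. T b \<le> ennreal (\<kappa> * x b / r)"
    and le: "\<forall>\<^sub>F b in F. opt b \<le> T b"
  shows "sim F T (\<lambda>b. ennreal (x b / r)) \<and> sim F (\<lambda>b. ennreal (x b / r)) opt"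
proof
  have lower_T: "\<forall>\<^sub>F b in F. ennreal (\<kappa> * x b / r) \<le> T b" if "0 < \<kappa>" "\<kappa> < 1" for \<kappa>
    using lower[OF that] le by eventually_elim (rule order_trans)
  have T: "((\<lambda>b. enn2real (T b) / (x b / r)) \<longlongrightarrow> 1) F"
    "\<forall>\<^sub>F b in F. 0 < x b \<and> 0 < enn2real (T b) \<and> T b = ennreal (enn2real (T b))"
    using tendsto_ratio_if_bounds[of x F r T] x r lower_T upper by blast+
  have "\<forall>\<^sub>F b in F. ennreal (enn2real (T b) / (x b / r)) = T b / ennreal (x b / r)"
    using T(2) by eventually_elim (use r in \<open>metis divide_ennreal divide_pos_pos less_imp_le\<close>)
  then show "sim F T (\<lambda>b. ennreal (x b / r))"
    unfolding sim_def using tendsto_ennrealI[OF T(1)] by (simp add: tendsto_cong)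
  have upper_opt: "\<forall>\<^sub>F b in F. opt b \<le> ennreal (\<kappa> * x b / r)" if "1 < \<kappa>" for \<kappa>
    using upper[OF that] le by eventually_elim (rule order_trans[rotated])
  have opt: "((\<lambda>b. enn2real (opt b) / (x b / r)) \<longlongrightarrow> 1) F"
    "\<forall>\<^sub>F b in F. 0 < x b \<and> 0 < enn2real (opt b) \<and> opt b = ennreal (enn2real (opt b))"
    using tendsto_ratio_if_bounds[of x F r opt] x r lower upper_opt by blast+
  have "\<forall>\<^sub>F b in F. ennreal (inverse (enn2real (opt b) / (x b / r))) = ennreal (x b / r) / opt b"
    using opt(2)
  proof eventually_elim
    case (elim b)
    then have "ennreal (x b / r) / opt b = ennreal (x b / r) / ennreal (enn2real (opt b))" by simp
    also have "\<dots> = ennreal ((x b / r) / enn2real (opt b))"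
      using elim r by (intro divide_ennreal) auto
    finally show ?case by (simp add: mult.commute)
  qed
  then show "sim F (\<lambda>b. ennreal (x b / r)) opt"
    unfolding sim_def using tendsto_ennrealI[OF tendsto_inverse[OF opt(1)]] by (simp add: tendsto_cong)
qed

lemma eventually_le_if_sim:
  fixes f g :: "'b \<Rightarrow> real"
  assumes "sim F f g" "\<forall>\<^sub>F b in F. 0 < g b" "1 < c"
  shows "\<forall>\<^sub>F b in F. f b \<le> c * g b"
proof -
  have "\<forall>\<^sub>F b in F. f b / g b < c"
    using assms(1,3) unfolding sim_def by (intro order_tendstoD(2))
  with assms(2) show ?thesis by eventually_elim (simp add: field_simps)
qed

lemma such_that_dominates_le: "such_that_dominates F f g \<le> F"
  by (simp add: such_that_dominates_def)

lemma eventually_dominated: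
  assumes "\<forall>\<^sub>F b in F. 0 < g b" "0 < \<eta>"
  shows "\<forall>\<^sub>F b in such_that_dominates F f g. g b \<le> \<eta> * f b"
proof -
  have "filterlim (\<lambda>b. f b / g b) at_top (such_that_dominates F f g)"
    unfolding such_that_dominates_def by (rule filterlim_mono[OF filterlim_filtercomap]) auto
  then have "\<forall>\<^sub>F b in such_that_dominates F f g. 1 / \<eta> \<le> f b / g b"
    unfolding filterlim_at_top by blast
  with filter_leD[OF such_that_dominates_le assms(1)] show ?thesis
    by eventually_elim (use assms(2) in \<open>simp add: field_simps\<close>)
qed

lemma filterlim_levels2:
  "filterlim fst (at_right 0) levels2" "filterlim snd (at_right 0) levels2"
  unfolding levels2_def by (rule filterlim_fst filterlim_snd)+

lemma filterlim_levels4: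
  "filterlim fst (at_right 0) levels4" "filterlim (\<lambda>p. fst (snd p)) (at_right 0) levels4"
  "filterlim (\<lambda>p. fst (snd (snd p))) (at_right 0) levels4"
  "filterlim (\<lambda>p. snd (snd (snd p))) (at_right 0) levels4"
  unfolding levels4_def
  by (rule filterlim_fst filterlim_compose[OF filterlim_fst filterlim_snd]
      filterlim_compose[OF filterlim_fst filterlim_compose[OF filterlim_snd filterlim_snd]]
      filterlim_compose[OF filterlim_snd filterlim_compose[OF filterlim_snd filterlim_snd]])+

lemma filterlim_abs_ln:
  assumes "filterlim a (at_right (0::real)) F"
  shows "filterlim (\<lambda>b. \<bar>ln (a b)\<bar>) at_top F" "\<forall>\<^sub>F b in F. 0 < \<bar>ln (a b)\<bar>" "\<forall>\<^sub>F b in F. a b \<in> {0<..<1}"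
proof -
  show "filterlim (\<lambda>b. \<bar>ln (a b)\<bar>) at_top F"
    unfolding filterlim_at_top
  proof
    fix K
    show "\<forall>\<^sub>F b in F. K \<le> \<bar>ln (a b)\<bar>"
      using eventually_compose_filterlim[OF eventually_abs_ln_ge[of K] assms] by (rule eventually_mono) blast
  qed
  then show "\<forall>\<^sub>F b in F. 0 < \<bar>ln (a b)\<bar>" unfolding filterlim_at_top_dense by blast
  show "\<forall>\<^sub>F b in F. a b \<in> {0<..<1}"
    using eventually_compose_filterlim[OF eventually_abs_ln_ge[of 0] assms] by eventually_elim simp
qed

text \<open>
  Under familywise error control the rate is a maximum over the signals; it is attained where the
  isolation information is least.
\<close>

lemma Max_divide_min_eq:
  fixes f :: "'b \<Rightarrow> real"
  assumes "finite S" "S \<noteq> {}" "0 < c" "\<And>e. e \<in> S \<Longrightarrow> 0 < f e" "0 \<le> x"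
  shows "Max ((\<lambda>e. x / min c (f e)) ` S) = x / min c (Min (f ` S))"
proof (rule Max_eqI)
  have "Min (f ` S) \<in> f ` S" using assms by (intro Min_in) auto
  then show "x / min c (Min (f ` S)) \<in> (\<lambda>e. x / min c (f e)) ` S" by auto
  have pos: "0 < Min (f ` S)" using assms by (subst Min_gr_iff) auto
  fix y assume "y \<in> (\<lambda>e. x / min c (f e)) ` S"
  then obtain e where e: "e \<in> S" "y = x / min c (f e)" by auto
  have "min c (Min (f ` S)) \<le> min c (f e)" using e assms by (intro min.mono) auto
  then show "y \<le> x / min c (Min (f ` S))"
    unfolding e(2) using assms(3,4,5) pos e(1) by (intro divide_left_mono mult_pos_pos) auto
qed (use assms in simp)

section \<open>Asymptotic optimality\<close>

theorem theorem4p5: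
  fixes M :: "'a multisource" and I :: "'a info" and P :: "'a path measure"
    and Cd Dd :: "real \<Rightarrow> real \<Rightarrow> thresholds"
    and dd :: "real \<Rightarrow> real \<Rightarrow> 'a path \<Rightarrow> nat set set"
    and A B C D :: "real \<Rightarrow> real \<Rightarrow> real \<Rightarrow> real \<Rightarrow> thresholds"
    and d :: "real \<Rightarrow> real \<Rightarrow> real \<Rightarrow> real \<Rightarrow> 'a path \<Rightarrow> nat set set"
    and Af Bf :: "real \<Rightarrow> real \<Rightarrow> thresholds"
    and df :: "real \<Rightarrow> real \<Rightarrow> 'a path \<Rightarrow> nat set set"
  assumes setting: "multisource_setting M"
    and info: "info_positive M I" "cond_M M I" "cond_CC M I"
    and empty_Psi: "{} \<in> Psi M"
    and P: "P \<in> P_Psi M - H0 M"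
    and detection_subsystems:
      "Max ((\<lambda>e. info_min M I P (H0 M) (subdet M e)) ` signals M P) =
       info_min M I P (H0 M) (sources M)"
    \<comment> \<open>the detection procedure\<close>
    and pos_det: "\<And>\<alpha> \<beta> e. \<lbrakk>\<alpha> \<in> {0<..<1}; \<beta> \<in> {0<..<1}; e \<in> units M\<rbrakk>
        \<Longrightarrow> 0 < Cd \<alpha> \<beta> e \<and> 0 < Dd \<alpha> \<beta> e"
    and dec_det: "\<And>\<alpha> \<beta>. \<lbrakk>\<alpha> \<in> {0<..<1}; \<beta> \<in> {0<..<1}\<rbrakk>
        \<Longrightarrow> decision_det M (Cd \<alpha> \<beta>) (Dd \<alpha> \<beta>) (dd \<alpha> \<beta>)"
    and class_det: "\<And>\<alpha> \<beta>. \<lbrakk>\<alpha> \<in> {0<..<1}; \<beta> \<in> {0<..<1}\<rbrakk>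
        \<Longrightarrow> (T_star_det M (Cd \<alpha> \<beta>) (Dd \<alpha> \<beta>), dd \<alpha> \<beta>) \<in> D_class M \<alpha> \<beta>"
    and asymp_det: "\<And>e. e \<in> units M \<Longrightarrow>
        sim levels2 (\<lambda>(\<alpha>, \<beta>). ln (Cd \<alpha> \<beta> e)) (\<lambda>(\<alpha>, \<beta>). \<bar>ln \<beta>\<bar>) \<and>
        sim levels2 (\<lambda>(\<alpha>, \<beta>). ln (Dd \<alpha> \<beta> e)) (\<lambda>(\<alpha>, \<beta>). \<bar>ln \<alpha>\<bar>)"
    \<comment> \<open>the joint detection and isolation procedure\<close>
    and pos_joint: "\<And>\<alpha> \<beta> \<gamma> \<delta> e.
        \<lbrakk>\<alpha> \<in> {0<..<1}; \<beta> \<in> {0<..<1}; \<gamma> \<in> {0<..<1}; \<delta> \<in> {0<..<1}; e \<in> units M\<rbrakk>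
        \<Longrightarrow> 0 < A \<alpha> \<beta> \<gamma> \<delta> e \<and> 0 < B \<alpha> \<beta> \<gamma> \<delta> e \<and> 0 < C \<alpha> \<beta> \<gamma> \<delta> e \<and> 0 < D \<alpha> \<beta> \<gamma> \<delta> e"
    and dec_joint: "\<And>\<alpha> \<beta> \<gamma> \<delta>.
        \<lbrakk>\<alpha> \<in> {0<..<1}; \<beta> \<in> {0<..<1}; \<gamma> \<in> {0<..<1}; \<delta> \<in> {0<..<1}\<rbrakk>
        \<Longrightarrow> decision_joint M (A \<alpha> \<beta> \<gamma> \<delta>) (B \<alpha> \<beta> \<gamma> \<delta>) (C \<alpha> \<beta> \<gamma> \<delta>) (D \<alpha> \<beta> \<gamma> \<delta>) (d \<alpha> \<beta> \<gamma> \<delta>)"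
    and class_joint: "\<And>\<alpha> \<beta> \<gamma> \<delta>.
        \<lbrakk>\<alpha> \<in> {0<..<1}; \<beta> \<in> {0<..<1}; \<gamma> \<in> {0<..<1}; \<delta> \<in> {0<..<1}\<rbrakk>
        \<Longrightarrow> (T_star M (A \<alpha> \<beta> \<gamma> \<delta>) (B \<alpha> \<beta> \<gamma> \<delta>) (C \<alpha> \<beta> \<gamma> \<delta>) (D \<alpha> \<beta> \<gamma> \<delta>), d \<alpha> \<beta> \<gamma> \<delta>)
              \<in> C_class M \<alpha> \<beta> \<gamma> \<delta>"
    and asymp_joint: "\<And>e. e \<in> units M \<Longrightarrow>
        sim levels4 (\<lambda>(\<alpha>, \<beta>, \<gamma>, \<delta>). ln (A \<alpha> \<beta> \<gamma> \<delta> e)) (\<lambda>(\<alpha>, \<beta>, \<gamma>, \<delta>). \<bar>ln \<delta>\<bar>) \<and>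
        sim levels4 (\<lambda>(\<alpha>, \<beta>, \<gamma>, \<delta>). ln (B \<alpha> \<beta> \<gamma> \<delta> e)) (\<lambda>(\<alpha>, \<beta>, \<gamma>, \<delta>). \<bar>ln \<gamma>\<bar>) \<and>
        sim levels4 (\<lambda>(\<alpha>, \<beta>, \<gamma>, \<delta>). ln (C \<alpha> \<beta> \<gamma> \<delta> e)) (\<lambda>(\<alpha>, \<beta>, \<gamma>, \<delta>). \<bar>ln \<beta>\<bar>) \<and>
        sim levels4 (\<lambda>(\<alpha>, \<beta>, \<gamma>, \<delta>). ln (D \<alpha> \<beta> \<gamma> \<delta> e)) (\<lambda>(\<alpha>, \<beta>, \<gamma>, \<delta>). \<bar>ln \<alpha>\<bar>)"
    \<comment> \<open>the procedure with familywise error control: \<open>C = A\<close> and \<open>D = B\<close>\<close>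
    and pos_fwer: "\<And>\<gamma> \<delta> e. \<lbrakk>\<gamma> \<in> {0<..<1}; \<delta> \<in> {0<..<1}; e \<in> units M\<rbrakk>
        \<Longrightarrow> 0 < Af \<gamma> \<delta> e \<and> 0 < Bf \<gamma> \<delta> e"
    and dec_fwer: "\<And>\<gamma> \<delta>. \<lbrakk>\<gamma> \<in> {0<..<1}; \<delta> \<in> {0<..<1}\<rbrakk>
        \<Longrightarrow> decision_joint M (Af \<gamma> \<delta>) (Bf \<gamma> \<delta>) (Af \<gamma> \<delta>) (Bf \<gamma> \<delta>) (df \<gamma> \<delta>)"
    and class_fwer: "\<And>\<gamma> \<delta>. \<lbrakk>\<gamma> \<in> {0<..<1}; \<delta> \<in> {0<..<1}\<rbrakk>
        \<Longrightarrow> (T_star M (Af \<gamma> \<delta>) (Bf \<gamma> \<delta>) (Af \<gamma> \<delta>) (Bf \<gamma> \<delta>), df \<gamma> \<delta>) \<in> E_class M \<gamma> \<delta>"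
    and asymp_fwer: "\<And>e. e \<in> units M \<Longrightarrow>
        sim levels2 (\<lambda>(\<gamma>, \<delta>). ln (Af \<gamma> \<delta> e)) (\<lambda>(\<gamma>, \<delta>). \<bar>ln \<delta>\<bar>) \<and>
        sim levels2 (\<lambda>(\<gamma>, \<delta>). ln (Bf \<gamma> \<delta> e)) (\<lambda>(\<gamma>, \<delta>). \<bar>ln \<gamma>\<bar>)"
  shows
    "(sim levels2
       (\<lambda>(\<alpha>, \<beta>). expected_time P (T_star_det M (Cd \<alpha> \<beta>) (Dd \<alpha> \<beta>)))
       (\<lambda>(\<alpha>, \<beta>). ennreal (\<bar>ln \<alpha>\<bar> / info_min M I P (H0 M) (sources M))) \<and>
     sim levels2
       (\<lambda>(\<alpha>, \<beta>). ennreal (\<bar>ln \<alpha>\<bar> / info_min M I P (H0 M) (sources M)))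
       (\<lambda>(\<alpha>, \<beta>). optimal_time P (D_class M \<alpha> \<beta>))) \<and>
    (let F = such_that_dominates levels4
               (\<lambda>(\<alpha>, \<beta>, \<gamma>, \<delta>). \<bar>ln \<alpha>\<bar>) (\<lambda>(\<alpha>, \<beta>, \<gamma>, \<delta>). max \<bar>ln \<gamma>\<bar> \<bar>ln \<delta>\<bar>)
     in
       sim F
         (\<lambda>(\<alpha>, \<beta>, \<gamma>, \<delta>). expected_time P
            (T_star M (A \<alpha> \<beta> \<gamma> \<delta>) (B \<alpha> \<beta> \<gamma> \<delta>) (C \<alpha> \<beta> \<gamma> \<delta>) (D \<alpha> \<beta> \<gamma> \<delta>)))
         (\<lambda>(\<alpha>, \<beta>, \<gamma>, \<delta>). ennreal (\<bar>ln \<alpha>\<bar> / info_min M I P (H0 M) (sources M))) \<and>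
       sim F
         (\<lambda>(\<alpha>, \<beta>, \<gamma>, \<delta>). ennreal (\<bar>ln \<alpha>\<bar> / info_min M I P (H0 M) (sources M)))
         (\<lambda>(\<alpha>, \<beta>, \<gamma>, \<delta>). optimal_time P (C_class M \<alpha> \<beta> \<gamma> \<delta>))) \<and>
    (Min ((\<lambda>e. info_min M I P (H_Psi M e) (subiso M e)) ` signals M P) =
     Min ((\<lambda>e. info_min M I P (H_Psi M e) (sources M)) ` signals M P) \<longrightarrow>
     (let F = such_that_dominates levels2 (\<lambda>(\<gamma>, \<delta>). \<bar>ln \<gamma>\<bar>) (\<lambda>(\<gamma>, \<delta>). \<bar>ln \<delta>\<bar>);
          rate = (\<lambda>(\<gamma>, \<delta>). ennreal (Max ((\<lambda>e. \<bar>ln \<gamma>\<bar> /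
                    min (info_min M I P (H0 M) (sources M)) (info_min M I P (H_Psi M e) (sources M)))
                  ` signals M P)))
      in
        sim F
          (\<lambda>(\<gamma>, \<delta>). expected_time P (T_star M (Af \<gamma> \<delta>) (Bf \<gamma> \<delta>) (Af \<gamma> \<delta>) (Bf \<gamma> \<delta>)))
          rate \<and>
        sim F rate (\<lambda>(\<gamma>, \<delta>). optimal_time P (E_class M \<gamma> \<delta>))))"
proof -
  interpret multisource_model M by (rule multisource_model.intro) (rule setting)
  let ?s = "sources M"
  define I0 where "I0 = info_min M I P (H0 M) ?s"
  have G: "P \<in> G_Psi M e" "e \<in> units M" if "e \<in> signals M P" for e
    using that P signals_units by (auto simp: G_Psi_def)
  have sig_ne: "signals M P \<noteq> {}"
    using P by (auto simp: signals_def P_Psi_def H0_def)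
  have "Max ((\<lambda>e. info_min M I P (H0 M) (subdet M e)) ` signals M P)
      \<in> (\<lambda>e. info_min M I P (H0 M) (subdet M e)) ` signals M P"
    using sig_ne finite_signals by (intro Max_in) auto
  \<comment> \<open>The signal whose detection subsystem carries the full information against \<open>H0 M\<close>.\<close>
  then obtain e0 where e0: "e0 \<in> signals M P" "I0 = info_min M I P (H0 M) (subdet M e0)"
    unfolding detection_subsystems I0_def by auto
  define J where "J = Min ((\<lambda>e. info_min M I P (H_Psi M e) (subiso M e)) ` signals M P)"
  have J_le: "J \<le> info_min M I P (H_Psi M e) (subiso M e)" if "e \<in> signals M P" for e
    unfolding J_def using that finite_signals by auto
  have J: "0 < J"
    unfolding J_def using sig_ne finite_signals G
  proof (subst Min_gr_iff; clarsimp)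
    fix e assume "e \<in> signals M P"
    note e = G[OF this]
    show "0 < info_min M I P (H_Psi M e) (subiso M e)"
      by (rule info_min_pos[OF info(1) e unit_le_subiso[OF e(2)] subiso_le_sources[OF e(2)] finite_H_Psi H_Psi_nonempty[OF e(2)]]) simp
  qed
  have J_sources_pos: "0 < info_min M I P (H_Psi M e) ?s" if "e \<in> signals M P" for e
  proof -
    note e = G[OF that]
    show ?thesis
      by (rule info_min_pos[OF info(1) e unit_le_sources[OF e(2)] order_refl finite_H_Psi H_Psi_nonempty[OF e(2)]]) simp
  qed
  have I0: "0 < I0"
    unfolding I0_def
    by (rule info_min_pos[OF info(1) G[OF e0(1)] unit_le_sources[OF G(2)[OF e0(1)]] order_refl finite_H0 H0_nonempty]) simp
  \<comment> \<open>The least favourable null law.\<close>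
  obtain Q0 where Q0: "Q0 \<in> H0 M" "I0 = I (marg M ?s P) (marg M ?s Q0)"
    using info_min_attained[OF finite_H0 H0_nonempty] unfolding I0_def by metis
  have upper: "\<forall>\<^sub>F b in F. expected_time P (T_star M (A b) (B b) (C b) (D b)) \<le> ennreal (\<kappa> * x b / r)"
    if "0 < r" "filterlim x at_top F" "\<forall>\<^sub>F b in F. \<forall>e\<in>units M. 0 < A b e \<and> 0 < B b e \<and> 0 < D b e"
      "\<And>c. 1 < c \<Longrightarrow> \<forall>\<^sub>F b in F. ln (D b e0) \<le> c * x b * I0 / r"
      "\<And>c e. 1 < c \<Longrightarrow> e \<in> signals M P \<Longrightarrow> \<forall>\<^sub>F b in F. ln (B b e) \<le> c * x b * J / r"
      "\<And>\<eta> e. 0 < \<eta> \<Longrightarrow> e \<in> units M - signals M P \<Longrightarrow> \<forall>\<^sub>F b in F. ln (A b e) \<le> \<eta> * x b"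
      "1 < \<kappa>" for F :: "'b filter" and x and A B C D :: "'b \<Rightarrow> thresholds" and r \<kappa>
    by (rule T_star_asymptotic_upper_bound[OF info(1,3) P e0 J J_le that])
  have lower_H0: "\<forall>\<^sub>F x in F. ennreal (\<kappa> * \<bar>ln (a x)\<bar> / I0) \<le> optimal_time P (\<C> x)"
    if "\<kappa> < 1" "filterlim a (at_right 0) F" "filterlim b (at_right 0) F"
      "\<forall>\<^sub>F x in F. \<forall>(T, D)\<in>\<C> x. (T, D) \<in> tests M \<and>
        measure Q0 {\<omega> \<in> paths M. D \<omega> \<in> {d. d \<noteq> {}}} \<le> a x \<and>
        measure P {\<omega> \<in> paths M. D \<omega> \<notin> {d. d \<noteq> {}}} \<le> b x"
    for F :: "'b filter" and a b \<kappa> \<C>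
    unfolding Q0(2)
    by (rule optimal_time_asymptotic_lower_bound[OF info(1,2) G(2)[OF e0(1)] G(1)[OF e0(1)] UnI2[OF Q0(1)] that])
  have D_class_errors: "(T, D) \<in> tests M \<and>
      measure Q0 {\<omega> \<in> paths M. D \<omega> \<in> {d. d \<noteq> {}}} \<le> \<alpha> \<and>
      measure P {\<omega> \<in> paths M. D \<omega> \<notin> {d. d \<noteq> {}}} \<le> \<beta>" if "(T, D) \<in> D_class M \<alpha> \<beta>" for T D \<alpha> \<beta>
    using that Q0(1) P by (simp add: D_class_def)
  have le_scaled: "\<forall>\<^sub>F b in F. f b \<le> z * y b"
    if "sim F f g" "\<forall>\<^sub>F b in F. 0 < g b" "\<forall>\<^sub>F b in F. g b \<le> z / 2 * y b"
    for F :: "'b filter" and f g y :: "'b \<Rightarrow> real" and z :: real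
    using eventually_le_if_sim[OF that(1,2), of 2] that(3) by (auto elim: eventually_elim2)

  \<comment> \<open>Isolation thresholds equal to \<open>1\<close> have logarithm \<open>0\<close>, so the general upper bound loses nothing
    for pure detection.\<close>
  have det: "sim levels2 (\<lambda>p. expected_time P (T_star_det M (Cd (fst p) (snd p)) (Dd (fst p) (snd p))))
      (\<lambda>p. ennreal (\<bar>ln (fst p)\<bar> / I0)) \<and>
    sim levels2 (\<lambda>p. ennreal (\<bar>ln (fst p)\<bar> / I0)) (\<lambda>p. optimal_time P (D_class M (fst p) (snd p)))"
  proof (rule sim_if_bounds)
    note a = filterlim_abs_ln[OF filterlim_levels2(1)] and b = filterlim_abs_ln[OF filterlim_levels2(2)]
    show "filterlim (\<lambda>p. \<bar>ln (fst p)\<bar>) at_top levels2" by (rule a)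
    show "0 < I0" by (rule I0)
    show "\<forall>\<^sub>F p in levels2. ennreal (\<kappa> * \<bar>ln (fst p)\<bar> / I0) \<le> optimal_time P (D_class M (fst p) (snd p))"
      if "\<kappa> < 1" for \<kappa>
      using D_class_errors by (intro lower_H0[OF that filterlim_levels2] always_eventually) auto
    show "\<forall>\<^sub>F p in levels2. optimal_time P (D_class M (fst p) (snd p))
        \<le> expected_time P (T_star_det M (Cd (fst p) (snd p)) (Dd (fst p) (snd p)))"
      using a(3) b(3)
      by eventually_elim (use class_det in \<open>force simp: optimal_time_def intro: INF_lower2\<close>)
    fix \<kappa> :: real assume "1 < \<kappa>"
    have "\<forall>\<^sub>F p in levels2. expected_time P (T_star M (\<lambda>e. 1) (\<lambda>e. 1) (Cd (fst p) (snd p)) (Dd (fst p) (snd p)))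
        \<le> ennreal (\<kappa> * \<bar>ln (fst p)\<bar> / I0)"
    proof (rule upper[OF I0 a(1) _ _ _ _ \<open>1 < \<kappa>\<close>])
      show "\<forall>\<^sub>F p in levels2. \<forall>e\<in>units M. 0 < (1::real) \<and> 0 < (1::real) \<and> 0 < Dd (fst p) (snd p) e"
        using a(3) b(3) by eventually_elim (use pos_det in auto)
      fix c :: real assume "1 < c"
      then show "\<forall>\<^sub>F p in levels2. ln (Dd (fst p) (snd p) e0) \<le> c * \<bar>ln (fst p)\<bar> * I0 / I0"
        using eventually_le_if_sim[OF _ a(2), of "\<lambda>p. ln (Dd (fst p) (snd p) e0)" c]
          asymp_det[OF G(2)[OF e0(1)]] I0 by (simp add: case_prod_beta')
    qed (use I0 J in auto)
    then show "\<forall>\<^sub>F p in levels2. expected_time P (T_star_det M (Cd (fst p) (snd p)) (Dd (fst p) (snd p)))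
        \<le> ennreal (\<kappa> * \<bar>ln (fst p)\<bar> / I0)"
      by eventually_elim (rule order_trans[OF expected_time_mono[OF T_star_det_le_T_star]])
  qed

  \<comment> \<open>Here isolation takes a time of order \<open>max \<bar>ln \<gamma>\<bar> \<bar>ln \<delta>\<bar>\<close>, which is negligible compared with the
    detection time; the isolation subsystems only have to carry positive information.\<close>
  let ?a = "\<lambda>p::real \<times> real \<times> real \<times> real. fst p"
  let ?b = "\<lambda>p::real \<times> real \<times> real \<times> real. fst (snd p)"
  let ?c = "\<lambda>p::real \<times> real \<times> real \<times> real. fst (snd (snd p))"
  let ?d = "\<lambda>p::real \<times> real \<times> real \<times> real. snd (snd (snd p))"
  let ?at = "\<lambda>f p. f (?a p) (?b p) (?c p) (?d p)"
  define F4 where "F4 = such_that_dominates levels4 (\<lambda>p. \<bar>ln (?a p)\<bar>) (\<lambda>p. max \<bar>ln (?c p)\<bar> \<bar>ln (?d p)\<bar>)"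
  have F4_le: "F4 \<le> levels4" unfolding F4_def by (rule such_that_dominates_le)
  have joint: "sim F4 (\<lambda>p. expected_time P (T_star M (?at A p) (?at B p) (?at C p) (?at D p)))
      (\<lambda>p. ennreal (\<bar>ln (?a p)\<bar> / I0)) \<and>
    sim F4 (\<lambda>p. ennreal (\<bar>ln (?a p)\<bar> / I0)) (\<lambda>p. optimal_time P (?at (C_class M) p))"
  proof (rule sim_if_bounds)
    note lim = filterlim_levels4[THEN filterlim_mono, OF order_refl F4_le]
    note a = filterlim_abs_ln[OF lim(1)] and b = filterlim_abs_ln[OF lim(2)]
      and c = filterlim_abs_ln[OF lim(3)] and d = filterlim_abs_ln[OF lim(4)]
    have asymp: "sim F4 (\<lambda>p. ln (?at A p e)) (\<lambda>p. \<bar>ln (?d p)\<bar>)"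
      "sim F4 (\<lambda>p. ln (?at B p e)) (\<lambda>p. \<bar>ln (?c p)\<bar>)"
      "sim F4 (\<lambda>p. ln (?at D p e)) (\<lambda>p. \<bar>ln (?a p)\<bar>)" if "e \<in> units M" for e
      using asymp_joint[OF that] unfolding sim_def by (auto simp: case_prod_beta' intro: tendsto_mono[OF F4_le])
    have dominated: "\<forall>\<^sub>F p in F4. max \<bar>ln (?c p)\<bar> \<bar>ln (?d p)\<bar> \<le> \<eta> * \<bar>ln (?a p)\<bar>" if "0 < \<eta>" for \<eta>
      unfolding F4_def
    proof (rule eventually_dominated[OF _ that])
      show "\<forall>\<^sub>F p in levels4. 0 < max \<bar>ln (?c p)\<bar> \<bar>ln (?d p)\<bar>"
        using filterlim_abs_ln(2)[OF filterlim_levels4(3)] by eventually_elim simp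
    qed
    show "filterlim (\<lambda>p. \<bar>ln (?a p)\<bar>) at_top F4" by (rule a)
    show "0 < I0" by (rule I0)
    show "\<forall>\<^sub>F p in F4. ennreal (\<kappa> * \<bar>ln (?a p)\<bar> / I0) \<le> optimal_time P (?at (C_class M) p)"
      if "\<kappa> < 1" for \<kappa>
      using D_class_errors
      by (intro lower_H0[OF that lim(1,2)] always_eventually) (auto simp: C_class_def)
    show "\<forall>\<^sub>F p in F4. optimal_time P (?at (C_class M) p)
        \<le> expected_time P (T_star M (?at A p) (?at B p) (?at C p) (?at D p))"
      using a(3) b(3) c(3) d(3)
      by eventually_elim (use class_joint in \<open>force simp: optimal_time_def intro: INF_lower2\<close>)
    fix \<kappa> :: real assume "1 < \<kappa>"
    show "\<forall>\<^sub>F p in F4. expected_time P (T_star M (?at A p) (?at B p) (?at C p) (?at D p))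
        \<le> ennreal (\<kappa> * \<bar>ln (?a p)\<bar> / I0)"
    proof (rule upper[OF I0 a(1) _ _ _ _ \<open>1 < \<kappa>\<close>])
      show "\<forall>\<^sub>F p in F4. \<forall>e\<in>units M. 0 < ?at A p e \<and> 0 < ?at B p e \<and> 0 < ?at D p e"
        using a(3) b(3) c(3) d(3) by eventually_elim (use pos_joint in blast)
      show "\<forall>\<^sub>F p in F4. ln (?at D p e0) \<le> c * \<bar>ln (?a p)\<bar> * I0 / I0" if "1 < c" for c
        using eventually_le_if_sim[OF asymp(3)[OF G(2)[OF e0(1)]] a(2) that] I0 by simp
      show "\<forall>\<^sub>F p in F4. ln (?at B p e) \<le> c' * \<bar>ln (?a p)\<bar> * J / I0"
        if "1 < c'" "e \<in> signals M P" for c' e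
      proof -
        have "\<forall>\<^sub>F p in F4. \<bar>ln (?c p)\<bar> \<le> (c' * J / I0) / 2 * \<bar>ln (?a p)\<bar>"
          using dominated[of "(c' * J / I0) / 2"] that(1) I0 J by (auto elim: eventually_mono)
        from le_scaled[OF asymp(2)[OF G(2)[OF that(2)]] c(2) this]
        show ?thesis by eventually_elim (simp add: mult_ac)
      qed
      show "\<forall>\<^sub>F p in F4. ln (?at A p e) \<le> \<eta> * \<bar>ln (?a p)\<bar>"
        if "0 < \<eta>" "e \<in> units M - signals M P" for \<eta> e
        using dominated[of "\<eta> / 2"] that by (intro le_scaled[OF asymp(1) d(2)]) (auto elim: eventually_mono)
    qed
  qed

  \<comment> \<open>Detecting against \<open>H0 M\<close> and isolating against \<open>H_Psi M e\<close> now compete at the same level \<open>\<gamma>\<close>; the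
    smaller of the two information numbers decides. On the side of the lower bound, the least favourable
    \<open>Q\<close> is accordingly taken from \<open>H0 M\<close> or from some \<open>H_Psi M e\<close>.\<close>
  define r where "r = min I0 J"
  have r: "0 < r" "r \<le> I0" "r \<le> J" using I0 J by (auto simp: r_def)
  define F2 where "F2 = such_that_dominates levels2 (\<lambda>p. \<bar>ln (fst p)\<bar>) (\<lambda>p. \<bar>ln (snd p)\<bar>)"
  have F2_le: "F2 \<le> levels2" unfolding F2_def by (rule such_that_dominates_le)
  have fwer: "sim F2 (\<lambda>p. expected_time P (T_star M (Af (fst p) (snd p)) (Bf (fst p) (snd p)) (Af (fst p) (snd p)) (Bf (fst p) (snd p))))
      (\<lambda>p. ennreal (\<bar>ln (fst p)\<bar> / r)) \<and>
    sim F2 (\<lambda>p. ennreal (\<bar>ln (fst p)\<bar> / r)) (\<lambda>p. optimal_time P (E_class M (fst p) (snd p)))"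
    if iso: "J = Min ((\<lambda>e. info_min M I P (H_Psi M e) ?s) ` signals M P)"
  proof (rule sim_if_bounds)
    note lim = filterlim_levels2[THEN filterlim_mono, OF order_refl F2_le]
    note a = filterlim_abs_ln[OF lim(1)] and b = filterlim_abs_ln[OF lim(2)]
    have asymp: "sim F2 (\<lambda>p. ln (Af (fst p) (snd p) e)) (\<lambda>p. \<bar>ln (snd p)\<bar>)"
      "sim F2 (\<lambda>p. ln (Bf (fst p) (snd p) e)) (\<lambda>p. \<bar>ln (fst p)\<bar>)" if "e \<in> units M" for e
      using asymp_fwer[OF that] unfolding sim_def by (auto simp: case_prod_beta' intro: tendsto_mono[OF F2_le])
    have dominated: "\<forall>\<^sub>F p in F2. \<bar>ln (snd p)\<bar> \<le> \<eta> * \<bar>ln (fst p)\<bar>" if "0 < \<eta>" for \<eta>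
      unfolding F2_def by (rule eventually_dominated[OF filterlim_abs_ln(2)[OF filterlim_levels2(2)] that])
    have B_le: "\<forall>\<^sub>F p in F2. ln (Bf (fst p) (snd p) e) \<le> c * \<bar>ln (fst p)\<bar> * z / r"
      if "1 < c" "e \<in> signals M P" "r \<le> z" for c e z
      using eventually_le_if_sim[OF asymp(2)[OF G(2)[OF that(2)]] a(2) that(1)]
    proof eventually_elim
      case (elim p)
      also have "c * \<bar>ln (fst p)\<bar> = c * \<bar>ln (fst p)\<bar> * r / r" using r(1) by simp
      also have "\<dots> \<le> c * \<bar>ln (fst p)\<bar> * z / r"
        using that r(1) by (intro divide_right_mono mult_left_mono) auto
      finally show ?case .
    qed
    show "filterlim (\<lambda>p. \<bar>ln (fst p)\<bar>) at_top F2" by (rule a)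
    show "0 < r" by (rule r)
    show "\<forall>\<^sub>F p in F2. optimal_time P (E_class M (fst p) (snd p)) \<le> expected_time P
        (T_star M (Af (fst p) (snd p)) (Bf (fst p) (snd p)) (Af (fst p) (snd p)) (Bf (fst p) (snd p)))"
      using a(3) b(3)
      by eventually_elim (use class_fwer in \<open>force simp: optimal_time_def intro: INF_lower2\<close>)
    show "\<forall>\<^sub>F p in F2. expected_time P
        (T_star M (Af (fst p) (snd p)) (Bf (fst p) (snd p)) (Af (fst p) (snd p)) (Bf (fst p) (snd p)))
        \<le> ennreal (\<kappa> * \<bar>ln (fst p)\<bar> / r)" if "1 < \<kappa>" for \<kappa>
    proof (rule upper[OF r(1) a(1) _ _ _ _ that])
      show "\<forall>\<^sub>F p in F2. \<forall>e\<in>units M. 0 < Af (fst p) (snd p) e \<and> 0 < Bf (fst p) (snd p) e \<and> 0 < Bf (fst p) (snd p) e"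
        using a(3) b(3) by eventually_elim (use pos_fwer in blast)
      show "\<forall>\<^sub>F p in F2. ln (Bf (fst p) (snd p) e0) \<le> c * \<bar>ln (fst p)\<bar> * I0 / r" if "1 < c" for c
        by (rule B_le[OF that e0(1) r(2)])
      show "\<forall>\<^sub>F p in F2. ln (Bf (fst p) (snd p) e) \<le> c * \<bar>ln (fst p)\<bar> * J / r"
        if "1 < c" "e \<in> signals M P" for c e
        by (rule B_le[OF that r(3)])
      show "\<forall>\<^sub>F p in F2. ln (Af (fst p) (snd p) e) \<le> \<eta> * \<bar>ln (fst p)\<bar>"
        if "0 < \<eta>" "e \<in> units M - signals M P" for \<eta> e
        using dominated[of "\<eta> / 2"] that by (intro le_scaled[OF asymp(1) b(2)]) auto
    qed
    have missed: "measure P {\<omega> \<in> paths M. D \<omega> \<notin> S} \<le> \<delta>"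
      if test: "(T, D) \<in> E_class M \<gamma> \<delta>" and S: "\<And>d. d \<notin> S \<Longrightarrow> signals M P - d \<noteq> {}" for T D S \<gamma> \<delta>
    proof -
      have P_law: "P \<in> laws M" using P P_Psi_laws by blast
      interpret prob_space P by (rule law_prob_space[OF P_law])
      have "(T, D) \<in> tests M" using test by (simp add: E_class_def)
      from test_decision_in_law[OF P_law this, of "{d. signals M P - d \<noteq> {}}"]
      have "measure P {\<omega> \<in> paths M. D \<omega> \<notin> S} \<le> measure P {\<omega> \<in> paths M. signals M P - D \<omega> \<noteq> {}}"
        using S by (intro finite_measure_mono) auto
      also have "\<dots> \<le> \<delta>" using test P by (auto simp: E_class_def)
      finally show ?thesis .
    qed
    have false_alarm: "measure Q {\<omega> \<in> paths M. D \<omega> \<in> S} \<le> \<gamma>"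
      if test: "(T, D) \<in> E_class M \<gamma> \<delta>" and Q: "Q \<in> P_Psi M" and S: "\<And>d. d \<in> S \<Longrightarrow> d - signals M Q \<noteq> {}"
      for T D S Q \<gamma> \<delta>
    proof -
      have Q_law: "Q \<in> laws M" using Q P_Psi_laws by blast
      interpret prob_space Q by (rule law_prob_space[OF Q_law])
      have "(T, D) \<in> tests M" using test by (simp add: E_class_def)
      from test_decision_in_law[OF Q_law this, of "{d. d - signals M Q \<noteq> {}}"]
      have "measure Q {\<omega> \<in> paths M. D \<omega> \<in> S} \<le> measure Q {\<omega> \<in> paths M. D \<omega> - signals M Q \<noteq> {}}"
        using S by (intro finite_measure_mono) auto
      also have "\<dots> \<le> \<gamma>" using test Q by (auto simp: E_class_def)
      finally show ?thesis .
    qed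
    have E_class_errors: "\<forall>\<^sub>F p in F2. \<forall>(T, D)\<in>E_class M (fst p) (snd p). (T, D) \<in> tests M \<and>
        measure Q {\<omega> \<in> paths M. D \<omega> \<in> S} \<le> fst p \<and> measure P {\<omega> \<in> paths M. D \<omega> \<notin> S} \<le> snd p"
      if "Q \<in> P_Psi M" "\<And>d. d \<in> S \<Longrightarrow> d - signals M Q \<noteq> {}" "\<And>d. d \<notin> S \<Longrightarrow> signals M P - d \<noteq> {}" for Q S
    proof (intro always_eventually allI, clarify, intro conjI)
      fix \<gamma> \<delta> T D assume "(T, D) \<in> E_class M (fst (\<gamma>, \<delta>)) (snd (\<gamma>, \<delta>))"
      then have test: "(T, D) \<in> E_class M \<gamma> \<delta>" by simp
      then show "(T, D) \<in> tests M" by (simp add: E_class_def)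
      show "measure Q {\<omega> \<in> paths M. D \<omega> \<in> S} \<le> fst (\<gamma>, \<delta>)"
        using false_alarm[OF test that(1,2)] by simp
      show "measure P {\<omega> \<in> paths M. D \<omega> \<notin> S} \<le> snd (\<gamma>, \<delta>)"
        using missed[OF test that(3)] by simp
    qed
    fix \<kappa> :: real assume \<kappa>: "\<kappa> < 1"
    show "\<forall>\<^sub>F p in F2. ennreal (\<kappa> * \<bar>ln (fst p)\<bar> / r) \<le> optimal_time P (E_class M (fst p) (snd p))"
    proof (cases "I0 \<le> J")
      case True
      then have "r = I0" by (simp add: r_def)
      moreover have "Q0 \<in> P_Psi M" "signals M Q0 = {}"
      proof -
        show "signals M Q0 = {}" by (rule signals_H0[OF Q0(1)])
        with Q0(1) empty_Psi show "Q0 \<in> P_Psi M" by (auto simp: P_Psi_def H0_def)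
      qed
      ultimately show ?thesis
        using lower_H0[OF \<kappa> lim E_class_errors[of Q0 "{d. d \<noteq> {}}"]] sig_ne by simp
    next
      case False
      have "Min ((\<lambda>e. info_min M I P (H_Psi M e) ?s) ` signals M P)
          \<in> (\<lambda>e. info_min M I P (H_Psi M e) ?s) ` signals M P"
        using sig_ne finite_signals by (intro Min_in) auto
      then obtain e where e: "e \<in> signals M P" "J = info_min M I P (H_Psi M e) ?s"
        unfolding iso by auto
      obtain Q where Q: "Q \<in> H_Psi M e" "J = I (marg M ?s P) (marg M ?s Q)"
        using info_min_attained[OF finite_H_Psi H_Psi_nonempty[OF G(2)[OF e(1)]]] unfolding e(2) by metis
      have "r = I (marg M ?s P) (marg M ?s Q)" using False Q(2) by (simp add: r_def)
      moreover have "Q \<in> P_Psi M" "e \<notin> signals M Q" using Q(1) by (auto simp: H_Psi_def)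
      ultimately show ?thesis
        using optimal_time_asymptotic_lower_bound[OF info(1,2) G(2)[OF e(1)] G(1)[OF e(1)] UnI1[OF Q(1)] \<kappa> lim
            E_class_errors[of Q "{d. e \<in> d}"]] e(1) by auto
    qed
  qed
  have rate: "Max ((\<lambda>e. \<bar>ln \<gamma>\<bar> / min I0 (info_min M I P (H_Psi M e) ?s)) ` signals M P) = \<bar>ln \<gamma>\<bar> / r"
    if iso: "J = Min ((\<lambda>e. info_min M I P (H_Psi M e) ?s) ` signals M P)" for \<gamma>
    unfolding r_def iso using sig_ne finite_signals I0 J_sources_pos by (intro Max_divide_min_eq) auto
  show ?thesis
    unfolding Let_def I0_def[symmetric] J_def[symmetric]
    using det joint fwer rate by (simp add: case_prod_beta' F2_def F4_def)
qed

end
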